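(* Let $(\mathfrak{g},[~,~])$ be a Lie algebra over a field $\mathbf{k}$ and consider the corresponding braided vector space $(\mathbf{k}\oplus\mathfrak{g},S)$, where $S\big((a,x)\otimes(b,y)\big) = (b,y)\otimes(a,x)+(0,[x,y])\otimes(1,0)$ for $(a,x),(b,y)\in\mathbf{k}\oplus\mathfrak{g}$. A linear map $P:\mathfrak{g}\rightarrow\mathfrak{g}$ is an averaging operator on the Lie algebra $\mathfrak{g}$ if and only if the linear map $\mathcal{A}:\mathbf{k}\oplus\mathfrak{g}\rightarrow\mathbf{k}\oplus\mathfrak{g}$ defined by $\mathcal{A}(a,x)=(a,P(x))$ is an averaging operator on the braided vector space $(\mathbf{k}\oplus\mathfrak{g},S)$.
   Context: A braided vector space is a pair $(V,S)$ of a vector space $V$ and a linear map $S:V\otimes V\to V\otimes V$ satisfying the Yang-Baxter equation $(\mathrm{Id}\otimes S)(S\otimes\mathrm{Id})(\mathrm{Id}\otimes S) = (S\otimes\mathrm{Id})(\mathrm{Id}\otimes S)(S\otimes\mathrm{Id})$; it is known that, for a Lie algebra $(\mathfrak{g},[~,~])$ over a field $\mathbf{k}$, the linear map $S$ on $(\mathbf{k}\oplus\mathfrak{g})\otimes(\mathbf{k}\oplus\mathfrak{g})$ given by $S\big((a,x)\otimes(b,y)\big) = (b,y)\otimes(a,x)+(0,[x,y])\otimes(1,0)$ satisfies this. A (left) averaging operator on a braided vector space $(V,S)$ is a linear map $\mathcal{A}:V\to V$ satisfying $S(\mathcal{A}(x)\otimes\mathcal{A}(y)) = (\mathcal{A}\otimes\mathrm{Id})S(\mathcal{A}(x)\otimes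 y)$ for all $x,y\in V$. An averaging operator on a Lie algebra $\mathfrak{g}$ is a linear map $P:\mathfrak{g}\to\mathfrak{g}$ satisfying $[P(x),P(y)]=P[P(x),y]$ for all $x,y\in\mathfrak{g}$. *)

theory Defs
  imports "HOL-Algebra.Module" "HOL-Algebra.AbelCoset"
begin

section \<open>Linear algebra over a field, with explicit carriers\<close>

text \<open>
  A vector space over \<open>K\<close> is a \<^const>\<open>module\<close> over a \<^const>\<open>field\<close>.  The record of a module
  inherits the fields \<^const>\<open>mult\<close> and \<^const>\<open>one\<close> from rings; they play no role for modules and
  are left \<^const>\<open>undefined\<close> below.
\<close>

definition module_hom ::
    "('k, 'r) ring_scheme \<Rightarrow> ('k, 'a, 'm) module_scheme \<Rightarrow> ('k, 'b, 'n) module_scheme \<Rightarrow> ('a \<Rightarrow> 'b) set"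
  where "module_hom K M N =
    {h \<in> carrier M \<rightarrow> carrier N.
      (\<forall>x\<in>carrier M. \<forall>y\<in>carrier M. h (x \<oplus>\<^bsub>M\<^esub> y) = h x \<oplus>\<^bsub>N\<^esub> h y) \<and>
      (\<forall>a\<in>carrier K. \<forall>x\<in>carrier M. h (a \<odot>\<^bsub>M\<^esub> x) = a \<odot>\<^bsub>N\<^esub> h x)}"

definition ring_as_module :: "('k, 'r) ring_scheme \<Rightarrow> ('k, 'k) module"
  where "ring_as_module K =
    \<lparr>carrier = carrier K, mult = undefined, one = undefined,
     zero = \<zero>\<^bsub>K\<^esub>, add = (\<oplus>\<^bsub>K\<^esub>), smult = (\<otimes>\<^bsub>K\<^esub>)\<rparr>"

definition direct_sum :: "('k, 'a, 'm) module_scheme \<Rightarrow> ('k, 'b, 'n) module_scheme \<Rightarrow> ('k, 'a \<times> 'b) module"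
  where "direct_sum M N =
    \<lparr>carrier = carrier M \<times> carrier N, mult = undefined, one = undefined,
     zero = (\<zero>\<^bsub>M\<^esub>, \<zero>\<^bsub>N\<^esub>),
     add = (\<lambda>(x, y) (x', y'). (x \<oplus>\<^bsub>M\<^esub> x', y \<oplus>\<^bsub>N\<^esub> y')),
     smult = (\<lambda>a (x, y). (a \<odot>\<^bsub>M\<^esub> x, a \<odot>\<^bsub>N\<^esub> y))\<rparr>"

definition free_module :: "('k, 'r) ring_scheme \<Rightarrow> 'x set \<Rightarrow> ('k, 'x \<Rightarrow> 'k) module"
  where "free_module K X =
    \<lparr>carrier = {f \<in> X \<rightarrow>\<^sub>E carrier K. finite {x \<in> X. f x \<noteq> \<zero>\<^bsub>K\<^esub>}},
     mult = undefined, one = undefined,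
     zero = (\<lambda>x\<in>X. \<zero>\<^bsub>K\<^esub>),
     add = (\<lambda>f g. \<lambda>x\<in>X. f x \<oplus>\<^bsub>K\<^esub> g x),
     smult = (\<lambda>a f. \<lambda>x\<in>X. a \<otimes>\<^bsub>K\<^esub> f x)\<rparr>"

definition free_gen :: "('k, 'r) ring_scheme \<Rightarrow> 'x set \<Rightarrow> 'x \<Rightarrow> 'x \<Rightarrow> 'k"
  where "free_gen K X x = (\<lambda>y\<in>X. if y = x then \<one>\<^bsub>K\<^esub> else \<zero>\<^bsub>K\<^esub>)"

definition submodule_span :: "('k, 'r) ring_scheme \<Rightarrow> ('k, 'a, 'm) module_scheme \<Rightarrow> 'a set \<Rightarrow> 'a set"
  where "submodule_span K M S = \<Inter>{H. submodule H K M \<and> S \<subseteq> H}"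

text \<open>The scalar multiple of the coset \<open>X = H + x\<close> is \<open>H + a X = H + a x\<close>.\<close>

definition quotient_module :: "('k, 'a, 'm) module_scheme \<Rightarrow> 'a set \<Rightarrow> ('k, 'a set) module"
  where "quotient_module M H =
    \<lparr>carrier = a_rcosets\<^bsub>M\<^esub> H, mult = undefined, one = undefined,
     zero = H, add = (<+>\<^bsub>M\<^esub>),
     smult = (\<lambda>a X. H <+>\<^bsub>M\<^esub> ((\<lambda>x. a \<odot>\<^bsub>M\<^esub> x) ` X))\<rparr>"


section \<open>Tensor products\<close>

definition tensor_relations ::
    "('k, 'r) ring_scheme \<Rightarrow> ('k, 'v, 'm) module_scheme \<Rightarrow> ('k, 'w, 'n) module_scheme \<Rightarrow> ('v \<times> 'w \<Rightarrow> 'k) set"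
  where "tensor_relations K V W =
    (let F = free_module K (carrier V \<times> carrier W);
         \<delta> = (\<lambda>v w. free_gen K (carrier V \<times> carrier W) (v, w))
     in {\<delta> (v \<oplus>\<^bsub>V\<^esub> v') w \<ominus>\<^bsub>F\<^esub> (\<delta> v w \<oplus>\<^bsub>F\<^esub> \<delta> v' w) | v v' w.
           v \<in> carrier V \<and> v' \<in> carrier V \<and> w \<in> carrier W} \<union>
        {\<delta> v (w \<oplus>\<^bsub>W\<^esub> w') \<ominus>\<^bsub>F\<^esub> (\<delta> v w \<oplus>\<^bsub>F\<^esub> \<delta> v w') | v w w'.
           v \<in> carrier V \<and> w \<in> carrier W \<and> w' \<in> carrier W} \<union>
        {\<delta> (a \<odot>\<^bsub>V\<^esub> v) w \<ominus>\<^bsub>F\<^esub> (a \<odot>\<^bsub>F\<^esub> \<delta> v w) | a v w.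
           a \<in> carrier K \<and> v \<in> carrier V \<and> w \<in> carrier W} \<union>
        {\<delta> v (a \<odot>\<^bsub>W\<^esub> w) \<ominus>\<^bsub>F\<^esub> (a \<odot>\<^bsub>F\<^esub> \<delta> v w) | a v w.
           a \<in> carrier K \<and> v \<in> carrier V \<and> w \<in> carrier W})"

definition tensor_null ::
    "('k, 'r) ring_scheme \<Rightarrow> ('k, 'v, 'm) module_scheme \<Rightarrow> ('k, 'w, 'n) module_scheme \<Rightarrow> ('v \<times> 'w \<Rightarrow> 'k) set"
  where "tensor_null K V W =
    submodule_span K (free_module K (carrier V \<times> carrier W)) (tensor_relations K V W)"

definition tensor_module ::
    "('k, 'r) ring_scheme \<Rightarrow> ('k, 'v, 'm) module_scheme \<Rightarrow> ('k, 'w, 'n) module_scheme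
      \<Rightarrow> ('k, ('v \<times> 'w \<Rightarrow> 'k) set) module"
  where "tensor_module K V W =
    quotient_module (free_module K (carrier V \<times> carrier W)) (tensor_null K V W)"

definition pure_tensor ::
    "('k, 'r) ring_scheme \<Rightarrow> ('k, 'v, 'm) module_scheme \<Rightarrow> ('k, 'w, 'n) module_scheme
      \<Rightarrow> 'v \<Rightarrow> 'w \<Rightarrow> ('v \<times> 'w \<Rightarrow> 'k) set"
  where "pure_tensor K V W v w =
    tensor_null K V W +>\<^bsub>free_module K (carrier V \<times> carrier W)\<^esub>
      free_gen K (carrier V \<times> carrier W) (v, w)"

definition bilinear_on ::
    "('k, 'r) ring_scheme \<Rightarrow> ('k, 'v, 'm) module_scheme \<Rightarrow> ('k, 'w, 'n) module_scheme
      \<Rightarrow> ('k, 'a, 'p) module_scheme \<Rightarrow> ('v \<Rightarrow> 'w \<Rightarrow> 'a) \<Rightarrow> bool"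
  where "bilinear_on K V W M b \<longleftrightarrow>
    (\<forall>v\<in>carrier V. \<forall>w\<in>carrier W. b v w \<in> carrier M) \<and>
    (\<forall>v\<in>carrier V. \<forall>v'\<in>carrier V. \<forall>w\<in>carrier W. b (v \<oplus>\<^bsub>V\<^esub> v') w = b v w \<oplus>\<^bsub>M\<^esub> b v' w) \<and>
    (\<forall>v\<in>carrier V. \<forall>w\<in>carrier W. \<forall>w'\<in>carrier W. b v (w \<oplus>\<^bsub>W\<^esub> w') = b v w \<oplus>\<^bsub>M\<^esub> b v w') \<and>
    (\<forall>a\<in>carrier K. \<forall>v\<in>carrier V. \<forall>w\<in>carrier W. b (a \<odot>\<^bsub>V\<^esub> v) w = a \<odot>\<^bsub>M\<^esub> b v w) \<and>
    (\<forall>a\<in>carrier K. \<forall>v\<in>carrier V. \<forall>w\<in>carrier W. b v (a \<odot>\<^bsub>W\<^esub> w) = a \<odot>\<^bsub>M\<^esub> b v w)"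

text \<open>
  The linear map on \<open>V \<otimes> W\<close> given on pure tensors by a bilinear map \<open>b\<close>.
  Existence and uniqueness are shown below (\<open>tensor_lift_unique_exists\<close>); extensionality is needed
  only because a function is unconstrained outside the carrier.
\<close>

definition tensor_lift ::
    "('k, 'r) ring_scheme \<Rightarrow> ('k, 'v, 'm) module_scheme \<Rightarrow> ('k, 'w, 'n) module_scheme
      \<Rightarrow> ('k, 'a, 'p) module_scheme \<Rightarrow> ('v \<Rightarrow> 'w \<Rightarrow> 'a) \<Rightarrow> ('v \<times> 'w \<Rightarrow> 'k) set \<Rightarrow> 'a"
  where "tensor_lift K V W M b =
    (THE h. h \<in> module_hom K (tensor_module K V W) M \<and>
            h \<in> extensional (carrier (tensor_module K V W)) \<and>
            (\<forall>v\<in>carrier V. \<forall>w\<in>carrier W. h (pure_tensor K V W v w) = b v w))"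

definition tensor_map ::
    "('k, 'r) ring_scheme \<Rightarrow> ('k, 'v, 'm) module_scheme \<Rightarrow> ('k, 'w, 'n) module_scheme
      \<Rightarrow> ('k, 'v2, 'm2) module_scheme \<Rightarrow> ('k, 'w2, 'n2) module_scheme
      \<Rightarrow> ('v \<Rightarrow> 'v2) \<Rightarrow> ('w \<Rightarrow> 'w2) \<Rightarrow> ('v \<times> 'w \<Rightarrow> 'k) set \<Rightarrow> ('v2 \<times> 'w2 \<Rightarrow> 'k) set"
  where "tensor_map K V W V' W' f g =
    tensor_lift K V W (tensor_module K V' W') (\<lambda>v w. pure_tensor K V' W' (f v) (g w))"

text \<open>The canonical map \<open>(U \<otimes> V) \<otimes> W \<rightarrow> U \<otimes> (V \<otimes> W)\<close>, \<open>(u \<otimes> v) \<otimes> w \<mapsto> u \<otimes> (v \<otimes> w)\<close>.\<close>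

definition tensor_assoc ::
    "('k, 'r) ring_scheme \<Rightarrow> ('k, 'u, 'l) module_scheme \<Rightarrow> ('k, 'v, 'm) module_scheme
      \<Rightarrow> ('k, 'w, 'n) module_scheme
      \<Rightarrow> (('u \<times> 'v \<Rightarrow> 'k) set \<times> 'w \<Rightarrow> 'k) set \<Rightarrow> ('u \<times> ('v \<times> 'w \<Rightarrow> 'k) set \<Rightarrow> 'k) set"
  where "tensor_assoc K U V W =
    tensor_lift K (tensor_module K U V) W (tensor_module K U (tensor_module K V W))
      (\<lambda>t w. tensor_lift K U V (tensor_module K U (tensor_module K V W))
        (\<lambda>u v. pure_tensor K U (tensor_module K V W) u (pure_tensor K V W v w)) t)"


section \<open>Braided vector spaces and averaging operators\<close>

text \<open>
  The Yang--Baxter equation is stated on \<open>V \<otimes> (V \<otimes> V)\<close>; \<open>S \<otimes> Id\<close> is defined on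
  \<open>(V \<otimes> V) \<otimes> V\<close> and transported along the associativity isomorphism (\<open>tensor_assoc_bij\<close> below).
\<close>

definition id_tensor ::
    "('k, 'r) ring_scheme \<Rightarrow> ('k, 'v, 'm) module_scheme
      \<Rightarrow> (('v \<times> 'v \<Rightarrow> 'k) set \<Rightarrow> ('v \<times> 'v \<Rightarrow> 'k) set)
      \<Rightarrow> ('v \<times> ('v \<times> 'v \<Rightarrow> 'k) set \<Rightarrow> 'k) set \<Rightarrow> ('v \<times> ('v \<times> 'v \<Rightarrow> 'k) set \<Rightarrow> 'k) set"
  where "id_tensor K V S =
    tensor_map K V (tensor_module K V V) V (tensor_module K V V) (\<lambda>v. v) S"

definition tensor_id ::
    "('k, 'r) ring_scheme \<Rightarrow> ('k, 'v, 'm) module_scheme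
      \<Rightarrow> (('v \<times> 'v \<Rightarrow> 'k) set \<Rightarrow> ('v \<times> 'v \<Rightarrow> 'k) set)
      \<Rightarrow> ('v \<times> ('v \<times> 'v \<Rightarrow> 'k) set \<Rightarrow> 'k) set \<Rightarrow> ('v \<times> ('v \<times> 'v \<Rightarrow> 'k) set \<Rightarrow> 'k) set"
  where "tensor_id K V S t =
    tensor_assoc K V V V
      (tensor_map K (tensor_module K V V) V (tensor_module K V V) V S (\<lambda>v. v)
        (inv_into (carrier (tensor_module K (tensor_module K V V) V)) (tensor_assoc K V V V) t))"

locale braided_vector_space = field K + module K V
  for K (structure) and V (structure) +
  fixes S :: "('b \<times> 'b \<Rightarrow> 'a) set \<Rightarrow> ('b \<times> 'b \<Rightarrow> 'a) set"
  assumes braiding_linear: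
      "S \<in> module_hom K (tensor_module K V V) (tensor_module K V V)"
    and yang_baxter:
      "t \<in> carrier (tensor_module K V (tensor_module K V V)) \<Longrightarrow>
        id_tensor K V S (tensor_id K V S (id_tensor K V S t)) =
        tensor_id K V S (id_tensor K V S (tensor_id K V S t))"

locale braided_averaging_operator = braided_vector_space K V S
  for K (structure) and V (structure) and S +
  fixes A :: "'b \<Rightarrow> 'b"
  assumes averaging_linear: "A \<in> module_hom K V V"
    and averaging:
      "\<lbrakk>x \<in> carrier V; y \<in> carrier V\<rbrakk> \<Longrightarrow>
        S (pure_tensor K V V (A x) (A y)) =
        tensor_map K V V V V A (\<lambda>v. v) (S (pure_tensor K V V (A x) y))"


section \<open>Lie algebras\<close>

locale lie_algebra = field K + module K G
  for K (structure) and G (structure) +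
  fixes bracket :: "'b \<Rightarrow> 'b \<Rightarrow> 'b"
  assumes bracket_closed:
      "\<lbrakk>x \<in> carrier G; y \<in> carrier G\<rbrakk> \<Longrightarrow> bracket x y \<in> carrier G"
    and bracket_add_left:
      "\<lbrakk>x \<in> carrier G; y \<in> carrier G; z \<in> carrier G\<rbrakk> \<Longrightarrow>
        bracket (x \<oplus>\<^bsub>G\<^esub> y) z = bracket x z \<oplus>\<^bsub>G\<^esub> bracket y z"
    and bracket_add_right:
      "\<lbrakk>x \<in> carrier G; y \<in> carrier G; z \<in> carrier G\<rbrakk> \<Longrightarrow>
        bracket x (y \<oplus>\<^bsub>G\<^esub> z) = bracket x y \<oplus>\<^bsub>G\<^esub> bracket x z"
    and bracket_smult_left:
      "\<lbrakk>a \<in> carrier K; x \<in> carrier G; y \<in> carrier G\<rbrakk> \<Longrightarrow>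
        bracket (a \<odot>\<^bsub>G\<^esub> x) y = a \<odot>\<^bsub>G\<^esub> bracket x y"
    and bracket_smult_right:
      "\<lbrakk>a \<in> carrier K; x \<in> carrier G; y \<in> carrier G\<rbrakk> \<Longrightarrow>
        bracket x (a \<odot>\<^bsub>G\<^esub> y) = a \<odot>\<^bsub>G\<^esub> bracket x y"
    and bracket_self:
      "x \<in> carrier G \<Longrightarrow> bracket x x = \<zero>\<^bsub>G\<^esub>"
    and jacobi:
      "\<lbrakk>x \<in> carrier G; y \<in> carrier G; z \<in> carrier G\<rbrakk> \<Longrightarrow>
        bracket x (bracket y z) \<oplus>\<^bsub>G\<^esub> bracket y (bracket z x) \<oplus>\<^bsub>G\<^esub> bracket z (bracket x y) = \<zero>\<^bsub>G\<^esub>"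

locale lie_averaging_operator = lie_algebra K G bracket
  for K (structure) and G (structure) and bracket +
  fixes P :: "'b \<Rightarrow> 'b"
  assumes averaging_linear: "P \<in> module_hom K G G"
    and averaging:
      "\<lbrakk>x \<in> carrier G; y \<in> carrier G\<rbrakk> \<Longrightarrow> bracket (P x) (P y) = P (bracket (P x) y)"

definition lie_braided_space ::
    "('k, 'r) ring_scheme \<Rightarrow> ('k, 'g, 'm) module_scheme \<Rightarrow> ('k, 'k \<times> 'g) module"
  where "lie_braided_space K G = direct_sum (ring_as_module K) G"

definition lie_braiding ::
    "('k, 'r) ring_scheme \<Rightarrow> ('k, 'g, 'm) module_scheme \<Rightarrow> ('g \<Rightarrow> 'g \<Rightarrow> 'g)
      \<Rightarrow> (('k \<times> 'g) \<times> ('k \<times> 'g) \<Rightarrow> 'k) set \<Rightarrow> (('k \<times> 'g) \<times> ('k \<times> 'g) \<Rightarrow> 'k) set"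
  where "lie_braiding K G bracket =
    (let V = lie_braided_space K G in
      tensor_lift K V V (tensor_module K V V)
        (\<lambda>(a, x) (b, y).
          pure_tensor K V V (b, y) (a, x)
          \<oplus>\<^bsub>tensor_module K V V\<^esub>
          pure_tensor K V V (\<zero>\<^bsub>K\<^esub>, bracket x y) (\<one>\<^bsub>K\<^esub>, \<zero>\<^bsub>G\<^esub>)))"


section \<open>The tensor product and its canonical maps are well defined\<close>

lemma (in abelian_group) minus_zero_imp_eq:
  assumes "x \<ominus> y = \<zero>" "x \<in> carrier G" "y \<in> carrier G" shows "x = y"
proof -
  have "x = (x \<ominus> y) \<oplus> y" using assms(2,3) by (simp add: a_minus_def a_assoc l_neg)
  then show ?thesis using assms by simp
qed

lemma module_homD:
  assumes "h \<in> module_hom K M N"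
  shows "x \<in> carrier M \<Longrightarrow> h x \<in> carrier N"
    and "x \<in> carrier M \<Longrightarrow> y \<in> carrier M \<Longrightarrow> h (x \<oplus>\<^bsub>M\<^esub> y) = h x \<oplus>\<^bsub>N\<^esub> h y"
    and "a \<in> carrier K \<Longrightarrow> x \<in> carrier M \<Longrightarrow> h (a \<odot>\<^bsub>M\<^esub> x) = a \<odot>\<^bsub>N\<^esub> h x"
  using assms by (auto simp: module_hom_def Pi_def)

lemma module_homI:
  assumes "\<And>x. x \<in> carrier M \<Longrightarrow> h x \<in> carrier N"
    and "\<And>x y. x \<in> carrier M \<Longrightarrow> y \<in> carrier M \<Longrightarrow> h (x \<oplus>\<^bsub>M\<^esub> y) = h x \<oplus>\<^bsub>N\<^esub> h y"
    and "\<And>a x. a \<in> carrier K \<Longrightarrow> x \<in> carrier M \<Longrightarrow> h (a \<odot>\<^bsub>M\<^esub> x) = a \<odot>\<^bsub>N\<^esub> h x"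
  shows "h \<in> module_hom K M N"
  using assms by (auto simp: module_hom_def Pi_def)

lemma module_hom_zero:
  assumes "module K M" "module K N" "h \<in> module_hom K M N"
  shows "h \<zero>\<^bsub>M\<^esub> = \<zero>\<^bsub>N\<^esub>"
proof -
  interpret M: module K M by fact
  interpret N: module K N by fact
  have "h (\<zero>\<^bsub>K\<^esub> \<odot>\<^bsub>M\<^esub> \<zero>\<^bsub>M\<^esub>) = \<zero>\<^bsub>K\<^esub> \<odot>\<^bsub>N\<^esub> h \<zero>\<^bsub>M\<^esub>"
    by (rule module_homD(3)[OF assms(3)]) auto
  then show ?thesis using module_homD(1)[OF assms(3), of "\<zero>\<^bsub>M\<^esub>"] M.smult_l_null N.smult_l_null by simp
qed

lemma module_hom_minus:
  assumes "module K M" "module K N" "h \<in> module_hom K M N" "x \<in> carrier M" "y \<in> carrier M"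
  shows "h (x \<ominus>\<^bsub>M\<^esub> y) = h x \<ominus>\<^bsub>N\<^esub> h y"
proof -
  interpret M: module K M by fact
  interpret N: module K N by fact
  have "h (x \<ominus>\<^bsub>M\<^esub> y) \<oplus>\<^bsub>N\<^esub> h y = h x"
    using module_homD[OF assms(3)] assms(4,5)
    by (metis M.add.inv_closed M.add.inv_solve_right' M.minus_closed a_minus_def)
  then show ?thesis using module_homD(1)[OF assms(3)] assms(4,5)
    by (metis N.add.inv_solve_right' M.minus_closed a_minus_def)
qed

lemma submodule_kernel:
  assumes "module K M" "module K N" "h \<in> module_hom K M N"
  shows "submodule {x \<in> carrier M. h x = \<zero>\<^bsub>N\<^esub>} K M"
proof -
  interpret M: module K M by fact
  interpret N: module K N by fact
  have n: "h (\<ominus>\<^bsub>M\<^esub> a) = \<zero>\<^bsub>N\<^esub>" if "a \<in> carrier M" "h a = \<zero>\<^bsub>N\<^esub>" for a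
    using module_hom_minus[OF assms, of "\<zero>\<^bsub>M\<^esub>" a] module_hom_zero[OF assms] that
    by (simp add: a_minus_def)
  show ?thesis
    by (rule M.submoduleI) (auto simp: module_hom_zero[OF assms] n module_homD[OF assms(3)])
qed

lemma submodule_span_submodule:
  assumes "module K M" "S \<subseteq> carrier M"
  shows "submodule (submodule_span K M S) K M" "S \<subseteq> submodule_span K M S"
proof -
  interpret M: module K M by fact
  note E = M.submoduleE
  have c: "submodule (carrier M) K M" by (rule M.carrier_is_submodule)
  show "submodule (submodule_span K M S) K M"
    unfolding submodule_span_def
  proof (rule M.submoduleI)
    show "\<Inter> {H. submodule H K M \<and> S \<subseteq> H} \<subseteq> carrier M" using c assms by auto
    show "\<zero>\<^bsub>M\<^esub> \<in> \<Inter> {H. submodule H K M \<and> S \<subseteq> H}"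
      using subgroup.one_closed[OF submodule.axioms(1)] by fastforce
  qed (auto dest: E)
  show "S \<subseteq> submodule_span K M S" by (auto simp: submodule_span_def)
qed

lemma submodule_span_least: "submodule H K M \<Longrightarrow> S \<subseteq> H \<Longrightarrow> submodule_span K M S \<subseteq> H"
  by (auto simp: submodule_span_def)

lemma free_module_module:
  fixes K :: "('a, 'r) ring_scheme" and X :: "'b set"
  assumes "cring K" shows "module K (free_module K X)"
proof -
  interpret K: cring K by fact
  let ?F = "free_module K X"
  have iff: "f \<in> carrier ?F \<longleftrightarrow> (\<forall>x\<in>X. f x \<in> carrier K) \<and> (\<forall>x. x \<notin> X \<longrightarrow> f x = undefined) \<and> finite {x \<in> X. f x \<noteq> \<zero>\<^bsub>K\<^esub>}" for f
    by (auto simp: free_module_def PiE_def extensional_def)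
  have app: "\<zero>\<^bsub>?F\<^esub> x = (if x \<in> X then \<zero>\<^bsub>K\<^esub> else undefined)"
    "(f \<oplus>\<^bsub>?F\<^esub> g) x = (if x \<in> X then f x \<oplus>\<^bsub>K\<^esub> g x else undefined)"
    "(a \<odot>\<^bsub>?F\<^esub> f) x = (if x \<in> X then a \<otimes>\<^bsub>K\<^esub> f x else undefined)" for f g a x
    by (simp_all add: free_module_def)
  have add: "f \<oplus>\<^bsub>?F\<^esub> g \<in> carrier ?F" if "f \<in> carrier ?F" "g \<in> carrier ?F" for f g
  proof -
    have "finite {x \<in> X. (f \<oplus>\<^bsub>?F\<^esub> g) x \<noteq> \<zero>\<^bsub>K\<^esub>}"
      by (rule finite_subset[of _ "{x \<in> X. f x \<noteq> \<zero>\<^bsub>K\<^esub>} \<union> {x \<in> X. g x \<noteq> \<zero>\<^bsub>K\<^esub>}"])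
        (use that in \<open>auto simp: iff app\<close>)
    then show ?thesis using that unfolding iff by (auto simp: app)
  qed
  have smu: "a \<odot>\<^bsub>?F\<^esub> f \<in> carrier ?F" if "f \<in> carrier ?F" "a \<in> carrier K" for f a
  proof -
    have "finite {x \<in> X. (a \<odot>\<^bsub>?F\<^esub> f) x \<noteq> \<zero>\<^bsub>K\<^esub>}"
      by (rule finite_subset[of _ "{x \<in> X. f x \<noteq> \<zero>\<^bsub>K\<^esub>}"])
        (use that in \<open>auto simp: iff app\<close>)
    then show ?thesis using that unfolding iff by (auto simp: app)
  qed
  have zer: "\<zero>\<^bsub>?F\<^esub> \<in> carrier ?F" unfolding iff by (auto simp: app)
  have cl: "f x \<in> carrier K" if "f \<in> carrier ?F" "x \<in> X" for f x using that by (auto simp: iff)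
  have out: "f x = undefined" if "f \<in> carrier ?F" "x \<notin> X" for f x using that by (auto simp: iff)
  have eqI: "f = g" if "f \<in> carrier ?F" "g \<in> carrier ?F" "\<And>x. x \<in> X \<Longrightarrow> f x = g x" for f g
    using that out[OF that(1)] out[OF that(2)] by (metis ext)
  show ?thesis
  proof (rule moduleI)
    show "abelian_group ?F"
    proof (rule abelian_groupI)
      fix f assume f: "f \<in> carrier ?F"
      show "\<exists>g\<in>carrier ?F. g \<oplus>\<^bsub>?F\<^esub> f = \<zero>\<^bsub>?F\<^esub>"
      proof (rule bexI)
        show 1: "(\<ominus>\<^bsub>K\<^esub> \<one>\<^bsub>K\<^esub>) \<odot>\<^bsub>?F\<^esub> f \<in> carrier ?F" using f by (intro smu) auto
        show "(\<ominus>\<^bsub>K\<^esub> \<one>\<^bsub>K\<^esub>) \<odot>\<^bsub>?F\<^esub> f \<oplus>\<^bsub>?F\<^esub> f = \<zero>\<^bsub>?F\<^esub>"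
          by (rule eqI) (use f 1 cl in \<open>auto simp: app add zer K.l_minus K.l_neg\<close>)
      qed
    next
      fix f g h assume f: "f \<in> carrier ?F" "g \<in> carrier ?F" "h \<in> carrier ?F"
      show "f \<oplus>\<^bsub>?F\<^esub> g \<oplus>\<^bsub>?F\<^esub> h = f \<oplus>\<^bsub>?F\<^esub> (g \<oplus>\<^bsub>?F\<^esub> h)"
        by (rule eqI) (use f in \<open>simp_all add: app add cl K.a_assoc\<close>)
    next
      fix f g assume f: "f \<in> carrier ?F" "g \<in> carrier ?F"
      show "f \<oplus>\<^bsub>?F\<^esub> g = g \<oplus>\<^bsub>?F\<^esub> f"
        by (rule eqI) (use f in \<open>simp_all add: app add cl K.a_comm\<close>)
    next
      fix f assume f: "f \<in> carrier ?F"
      show "\<zero>\<^bsub>?F\<^esub> \<oplus>\<^bsub>?F\<^esub> f = f"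
        by (rule eqI) (use f in \<open>simp_all add: app add zer cl\<close>)
    qed (fact add zer)+
  next
    fix a b f assume a: "a \<in> carrier K" "b \<in> carrier K" and f: "f \<in> carrier ?F"
    show "(a \<oplus>\<^bsub>K\<^esub> b) \<odot>\<^bsub>?F\<^esub> f = a \<odot>\<^bsub>?F\<^esub> f \<oplus>\<^bsub>?F\<^esub> b \<odot>\<^bsub>?F\<^esub> f"
      by (rule eqI) (use a f in \<open>simp_all add: app add smu cl K.l_distr\<close>)
    show "a \<otimes>\<^bsub>K\<^esub> b \<odot>\<^bsub>?F\<^esub> f = a \<odot>\<^bsub>?F\<^esub> (b \<odot>\<^bsub>?F\<^esub> f)"
      by (rule eqI) (use a f in \<open>simp_all add: app smu cl K.m_assoc\<close>)
  next
    fix a f g assume a: "a \<in> carrier K" and f: "f \<in> carrier ?F" "g \<in> carrier ?F"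
    show "a \<odot>\<^bsub>?F\<^esub> (f \<oplus>\<^bsub>?F\<^esub> g) = a \<odot>\<^bsub>?F\<^esub> f \<oplus>\<^bsub>?F\<^esub> a \<odot>\<^bsub>?F\<^esub> g"
      by (rule eqI) (use a f in \<open>simp_all add: app add smu cl K.r_distr\<close>)
  next
    fix f assume f: "f \<in> carrier ?F"
    show "\<one>\<^bsub>K\<^esub> \<odot>\<^bsub>?F\<^esub> f = f"
      by (rule eqI) (use f in \<open>simp_all add: app smu cl\<close>)
  qed (use assms smu in auto)
qed

lemma free_gen_carrier:
  assumes "cring K" "x \<in> X" shows "free_gen K X x \<in> carrier (free_module K X)"
proof -
  interpret K: cring K by fact
  have "finite {y \<in> X. free_gen K X x y \<noteq> \<zero>\<^bsub>K\<^esub>}"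
    by (rule finite_subset[of _ "{x}"]) (auto simp: free_gen_def)
  moreover have "free_gen K X x \<in> X \<rightarrow>\<^sub>E carrier K" by (auto simp: free_gen_def)
  ultimately show ?thesis by (simp add: free_module_def)
qed

lemma free_submodule_all:
  assumes "cring K" "submodule H K (free_module K X)" "\<And>x. x \<in> X \<Longrightarrow> free_gen K X x \<in> H"
    and "f \<in> carrier (free_module K X)"
  shows "f \<in> H"
proof -
  interpret K: cring K by fact
  interpret F: module K "free_module K X" by (rule free_module_module) fact
  note E = F.submoduleE[OF assms(2)]
  have "finite Y \<Longrightarrow> \<forall>f\<in>carrier (free_module K X). {x\<in>X. f x \<noteq> \<zero>\<^bsub>K\<^esub>} \<subseteq> Y \<longrightarrow> f \<in> H" for Y
  proof (induction Y rule: finite_induct)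
    case empty
    have "f = \<zero>\<^bsub>free_module K X\<^esub>" if "f\<in>carrier (free_module K X)" "{x\<in>X. f x \<noteq> \<zero>\<^bsub>K\<^esub>} \<subseteq> {}" for f
    proof
      fix x show "f x = \<zero>\<^bsub>free_module K X\<^esub> x"
        using that by (cases "x \<in> X") (auto simp: free_module_def)
    qed
    moreover have "\<zero>\<^bsub>free_module K X\<^esub> \<in> H"
      using subgroup.one_closed[OF submodule.axioms(1)[OF assms(2)]] by simp
    ultimately show ?case by blast
  next
    case (insert p Y)
    show ?case
    proof (intro ballI impI)
      fix f assume f: "f\<in>carrier (free_module K X)" "{x\<in>X. f x \<noteq> \<zero>\<^bsub>K\<^esub>} \<subseteq> insert p Y"
      show "f \<in> H"
      proof (cases "p \<in> X")
        case False
        then have "{x\<in>X. f x \<noteq> \<zero>\<^bsub>K\<^esub>} \<subseteq> Y" using f(2) by blast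
        then show ?thesis using insert.IH f(1) by blast
      next
        case True
        let ?g = "\<lambda>x\<in>X. if x = p then \<zero>\<^bsub>K\<^esub> else f x"
        have cl: "f x \<in> carrier K" if "x \<in> X" for x using f that by (auto simp: free_module_def)
        have "finite {x \<in> X. ?g x \<noteq> \<zero>\<^bsub>K\<^esub>}"
          by (rule finite_subset[of _ "{x\<in>X. f x \<noteq> \<zero>\<^bsub>K\<^esub>}"]) (use f in \<open>auto simp: free_module_def\<close>)
        then have "?g \<in> carrier (free_module K X)" using cl by (auto simp: free_module_def)
        moreover have "{x\<in>X. ?g x \<noteq> \<zero>\<^bsub>K\<^esub>} \<subseteq> Y" using f(2) by auto
        ultimately have 1: "?g \<in> H" using insert.IH by blast
        have 3: "f = ?g \<oplus>\<^bsub>free_module K X\<^esub> (f p \<odot>\<^bsub>free_module K X\<^esub> free_gen K X p)"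
        proof
          fix x
          have "f x = undefined" if "x \<notin> X" using f(1) that by (auto simp: free_module_def)
          then show "f x = (?g \<oplus>\<^bsub>free_module K X\<^esub> (f p \<odot>\<^bsub>free_module K X\<^esub> free_gen K X p)) x"
            using cl[of x] cl[OF True] by (cases "x \<in> X"; cases "x = p") (simp_all add: free_module_def free_gen_def)
        qed
        have 2: "f p \<odot>\<^bsub>free_module K X\<^esub> free_gen K X p \<in> H"
          by (rule E(4)[OF cl[OF True] assms(3)[OF True]])
        show ?thesis using E(5)[OF 1 2] unfolding 3[symmetric] .
      qed
    qed
  qed
  moreover have "finite {x\<in>X. f x \<noteq> \<zero>\<^bsub>K\<^esub>}" using assms(4) by (auto simp: free_module_def)
  ultimately show ?thesis using assms(4) by blast
qed

lemma free_ext: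
  fixes K :: "('a, 'r) ring_scheme" and X :: "'c set"
  assumes "module K M" "\<And>x. x \<in> X \<Longrightarrow> b x \<in> carrier M"
  shows "\<exists>h\<in>module_hom K (free_module K X) M. \<forall>x\<in>X. h (free_gen K X x) = b x"
proof -
  interpret M: module K M by fact
  define s where "s f = {x\<in>X. f x \<noteq> \<zero>\<^bsub>K\<^esub>}" for f :: "'c \<Rightarrow> 'a"
  define h where "h f = (\<Oplus>\<^bsub>M\<^esub> x\<in>s f. f x \<odot>\<^bsub>M\<^esub> b x)" for f
  let ?F = "free_module K X"
  have cl: "f x \<in> carrier K" if "f \<in> carrier ?F" "x \<in> X" for f x
    using that by (auto simp: free_module_def)
  have app: "x \<in> X \<Longrightarrow> (f \<oplus>\<^bsub>?F\<^esub> g) x = f x \<oplus>\<^bsub>K\<^esub> g x"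
    "x \<in> X \<Longrightarrow> (a \<odot>\<^bsub>?F\<^esub> f) x = a \<otimes>\<^bsub>K\<^esub> f x" for f g a x
    by (simp_all add: free_module_def)
  have fs: "finite (s f)" if "f \<in> carrier ?F" for f using that by (auto simp: free_module_def s_def)
  have sup: "h f = (\<Oplus>\<^bsub>M\<^esub> x\<in>A. f x \<odot>\<^bsub>M\<^esub> b x)"
    if "f \<in> carrier ?F" "finite A" "s f \<subseteq> A" "A \<subseteq> X" for f A
    unfolding h_def
    by (rule M.add.finprod_mono_neutral_cong_left) (use that cl assms(2) in \<open>auto simp: s_def\<close>)
  interpret F: module K ?F by (rule free_module_module) (rule M.R.is_cring)
  have "h \<in> module_hom K ?F M"
  proof (rule module_homI)
    fix f g assume f: "f \<in> carrier ?F" and g: "g \<in> carrier ?F"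
    let ?A = "s f \<union> s g"
    have A: "finite ?A" "?A \<subseteq> X" using fs f g by (auto simp: s_def)
    have sb: "s (f \<oplus>\<^bsub>?F\<^esub> g) \<subseteq> ?A" by (auto simp: s_def free_module_def)
    show "h f \<in> carrier M" unfolding h_def
      by (rule M.finsum_closed) (use cl f assms(2) in \<open>auto simp: s_def\<close>)
    have "h (f \<oplus>\<^bsub>?F\<^esub> g) = (\<Oplus>\<^bsub>M\<^esub> x\<in>?A. (f \<oplus>\<^bsub>?F\<^esub> g) x \<odot>\<^bsub>M\<^esub> b x)"
      by (rule sup) (use A sb f g in auto)
    also have "\<dots> = (\<Oplus>\<^bsub>M\<^esub> x\<in>?A. f x \<odot>\<^bsub>M\<^esub> b x \<oplus>\<^bsub>M\<^esub> g x \<odot>\<^bsub>M\<^esub> b x)"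
      by (rule M.add.finprod_cong')
        (use A assms(2) cl f g in \<open>auto simp: app subset_iff M.smult_l_distr\<close>)
    also have "\<dots> = (\<Oplus>\<^bsub>M\<^esub> x\<in>?A. f x \<odot>\<^bsub>M\<^esub> b x) \<oplus>\<^bsub>M\<^esub> (\<Oplus>\<^bsub>M\<^esub> x\<in>?A. g x \<odot>\<^bsub>M\<^esub> b x)"
      by (rule M.finsum_addf) (use A assms(2) cl f g in \<open>auto simp: subset_iff\<close>)
    also have "\<dots> = h f \<oplus>\<^bsub>M\<^esub> h g"
      using sup[OF f A(1) _ A(2)] sup[OF g A(1) _ A(2)] by simp
    finally show "h (f \<oplus>\<^bsub>?F\<^esub> g) = h f \<oplus>\<^bsub>M\<^esub> h g" .
  next
    fix a f assume a: "a \<in> carrier K" and f: "f \<in> carrier ?F"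
    have A: "finite (s f)" "s f \<subseteq> X" using fs f by (auto simp: s_def)
    have sb: "s (a \<odot>\<^bsub>?F\<^esub> f) \<subseteq> s f" using a by (auto simp: s_def free_module_def)
    have "h (a \<odot>\<^bsub>?F\<^esub> f) = (\<Oplus>\<^bsub>M\<^esub> x\<in>s f. (a \<odot>\<^bsub>?F\<^esub> f) x \<odot>\<^bsub>M\<^esub> b x)"
      by (rule sup) (use A sb f a in auto)
    also have "\<dots> = (\<Oplus>\<^bsub>M\<^esub> x\<in>s f. a \<odot>\<^bsub>M\<^esub> (f x \<odot>\<^bsub>M\<^esub> b x))"
      by (rule M.add.finprod_cong')
        (use A assms(2) cl f a in \<open>auto simp: app subset_iff M.smult_assoc1\<close>)
    also have "\<dots> = a \<odot>\<^bsub>M\<^esub> h f" unfolding h_def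
      by (rule M.finsum_smult_ldistr[symmetric]) (use A assms(2) cl f a in \<open>auto simp: subset_iff\<close>)
    finally show "h (a \<odot>\<^bsub>?F\<^esub> f) = a \<odot>\<^bsub>M\<^esub> h f" .
  qed
  moreover have "h (free_gen K X x) = b x" if "x \<in> X" for x
  proof -
    have "h (free_gen K X x) = (\<Oplus>\<^bsub>M\<^esub> y\<in>{x}. free_gen K X x y \<odot>\<^bsub>M\<^esub> b y)"
      by (rule sup) (use that free_gen_carrier[OF M.R.is_cring that] in \<open>auto simp: s_def free_gen_def\<close>)
    then show ?thesis using that assms(2) by (simp add: free_gen_def)
  qed
  ultimately show ?thesis by (intro bexI[of _ h]) auto
qed

context
  fixes K (structure) and M (structure) and H
  assumes mod: "module K M" and sub: "submodule H K M"
begin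

interpretation M: module K M by (rule mod)
interpretation H: abelian_subgroup H M
  by (rule abelian_subgroupI3)
    (use submodule.axioms(1)[OF sub] M.abelian_group_axioms in \<open>auto simp: additive_subgroup_def\<close>)

lemma quotient_carrier: "carrier (quotient_module M H) = (\<lambda>x. H +>\<^bsub>M\<^esub> x) ` carrier M"
  by (auto simp: quotient_module_def A_RCOSETS_def')

lemma quotient_add:
  "x \<in> carrier M \<Longrightarrow> y \<in> carrier M \<Longrightarrow>
    (H +>\<^bsub>M\<^esub> x) \<oplus>\<^bsub>quotient_module M H\<^esub> (H +>\<^bsub>M\<^esub> y) = H +>\<^bsub>M\<^esub> (x \<oplus>\<^bsub>M\<^esub> y)"
  by (simp add: quotient_module_def H.a_rcos_sum)

lemma quotient_smult:
  assumes "a \<in> carrier K" "x \<in> carrier M"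
  shows "a \<odot>\<^bsub>quotient_module M H\<^esub> (H +>\<^bsub>M\<^esub> x) = H +>\<^bsub>M\<^esub> (a \<odot>\<^bsub>M\<^esub> x)"
proof -
  note E = M.submoduleE[OF sub]
  have z: "\<zero>\<^bsub>M\<^esub> \<in> H" using H.zero_closed .
  have "h \<oplus>\<^bsub>M\<^esub> a \<odot>\<^bsub>M\<^esub> (k \<oplus>\<^bsub>M\<^esub> x) = (h \<oplus>\<^bsub>M\<^esub> a \<odot>\<^bsub>M\<^esub> k) \<oplus>\<^bsub>M\<^esub> a \<odot>\<^bsub>M\<^esub> x" if "h \<in> H" "k \<in> H" for h k
    using that assms E(1) by (simp add: M.smult_r_distr M.a_assoc subset_iff)
  note eq = this
  have "H <+>\<^bsub>M\<^esub> (\<lambda>x. a \<odot>\<^bsub>M\<^esub> x) ` (H +>\<^bsub>M\<^esub> x) = {h \<oplus>\<^bsub>M\<^esub> a \<odot>\<^bsub>M\<^esub> (k \<oplus>\<^bsub>M\<^esub> x) | h k. h \<in> H \<and> k \<in> H}"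
    unfolding set_add_def' a_r_coset_def' by blast
  also have "\<dots> = {(h \<oplus>\<^bsub>M\<^esub> a \<odot>\<^bsub>M\<^esub> k) \<oplus>\<^bsub>M\<^esub> a \<odot>\<^bsub>M\<^esub> x | h k. h \<in> H \<and> k \<in> H}"
    using eq by (metis (no_types, lifting))
  also have "\<dots> = {h \<oplus>\<^bsub>M\<^esub> a \<odot>\<^bsub>M\<^esub> x | h. h \<in> H}"
  proof (intro equalityI subsetI)
    fix y assume "y \<in> {h \<oplus>\<^bsub>M\<^esub> a \<odot>\<^bsub>M\<^esub> x | h. h \<in> H}"
    then obtain h where h: "h \<in> H" "y = h \<oplus>\<^bsub>M\<^esub> a \<odot>\<^bsub>M\<^esub> x" by blast
    then have "y = (h \<oplus>\<^bsub>M\<^esub> a \<odot>\<^bsub>M\<^esub> \<zero>\<^bsub>M\<^esub>) \<oplus>\<^bsub>M\<^esub> a \<odot>\<^bsub>M\<^esub> x"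
      using assms E(1) by (simp add: subset_iff)
    with h z show "y \<in> {(h \<oplus>\<^bsub>M\<^esub> a \<odot>\<^bsub>M\<^esub> k) \<oplus>\<^bsub>M\<^esub> a \<odot>\<^bsub>M\<^esub> x | h k. h \<in> H \<and> k \<in> H}" by blast
  next
    fix y assume "y \<in> {(h \<oplus>\<^bsub>M\<^esub> a \<odot>\<^bsub>M\<^esub> k) \<oplus>\<^bsub>M\<^esub> a \<odot>\<^bsub>M\<^esub> x | h k. h \<in> H \<and> k \<in> H}"
    then obtain h k where h: "h \<in> H" "k \<in> H" "y = (h \<oplus>\<^bsub>M\<^esub> a \<odot>\<^bsub>M\<^esub> k) \<oplus>\<^bsub>M\<^esub> a \<odot>\<^bsub>M\<^esub> x" by blast
    then show "y \<in> {h \<oplus>\<^bsub>M\<^esub> a \<odot>\<^bsub>M\<^esub> x | h. h \<in> H}" using E(5)[OF h(1) E(4)[OF assms(1) h(2)]] by blast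
  qed
  also have "\<dots> = H +>\<^bsub>M\<^esub> (a \<odot>\<^bsub>M\<^esub> x)" unfolding a_r_coset_def' by blast
  finally have "H <+>\<^bsub>M\<^esub> (\<lambda>x. a \<odot>\<^bsub>M\<^esub> x) ` (H +>\<^bsub>M\<^esub> x) = H +>\<^bsub>M\<^esub> (a \<odot>\<^bsub>M\<^esub> x)" .
  then show ?thesis by (simp add: quotient_module_def)
qed

lemma quotient_zero: "\<zero>\<^bsub>quotient_module M H\<^esub> = H +>\<^bsub>M\<^esub> \<zero>\<^bsub>M\<^esub>"
  using M.submoduleE(1)[OF sub] by (simp add: quotient_module_def M.a_coset_add_zero)

lemma quotient_module_module: "module K (quotient_module M H)"
proof (rule moduleI)
  show "cring K" by (rule M.R.is_cring)
  show "abelian_group (quotient_module M H)"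
  proof (rule abelian_groupI)
    fix X assume "X \<in> carrier (quotient_module M H)"
    then obtain x where x: "x \<in> carrier M" "X = H +>\<^bsub>M\<^esub> x" by (auto simp: quotient_carrier)
    show "\<exists>Y\<in>carrier (quotient_module M H). Y \<oplus>\<^bsub>quotient_module M H\<^esub> X = \<zero>\<^bsub>quotient_module M H\<^esub>"
      by (rule bexI[of _ "H +>\<^bsub>M\<^esub> (\<ominus>\<^bsub>M\<^esub> x)"])
        (use x in \<open>auto simp: quotient_carrier quotient_zero quotient_add M.l_neg\<close>)
  qed (auto simp: quotient_carrier quotient_zero quotient_add M.a_ac)
qed (auto simp: quotient_carrier quotient_add quotient_smult M.smult_l_distr M.smult_r_distr M.smult_assoc1)

lemma quotient_eq_zero_iff: "x \<in> carrier M \<Longrightarrow> H +>\<^bsub>M\<^esub> x = H \<longleftrightarrow> x \<in> H"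
  using M.a_coset_join1 M.a_coset_join2 submodule.axioms(1)[OF sub] by metis

lemma quotient_hom: "(\<lambda>x. H +>\<^bsub>M\<^esub> x) \<in> module_hom K M (quotient_module M H)"
  by (rule module_homI) (auto simp: quotient_carrier quotient_add quotient_smult)

lemma quotient_lift:
  assumes "module K N" "h \<in> module_hom K M N" "\<And>x. x \<in> H \<Longrightarrow> h x = \<zero>\<^bsub>N\<^esub>"
  shows "\<exists>g\<in>module_hom K (quotient_module M H) N. \<forall>x\<in>carrier M. g (H +>\<^bsub>M\<^esub> x) = h x"
proof -
  interpret N: module K N by fact
  note E = M.submoduleE[OF sub]
  define g where "g X = h (SOME x. x \<in> X)" for X
  have g: "g (H +>\<^bsub>M\<^esub> x) = h x" if "x \<in> carrier M" for x
  proof -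
    have "x \<in> H +>\<^bsub>M\<^esub> x" using that by (rule H.a_rcos_self)
    then have "(SOME y. y \<in> H +>\<^bsub>M\<^esub> x) \<in> H +>\<^bsub>M\<^esub> x" by (rule someI)
    then obtain k where "k \<in> H" "(SOME y. y \<in> H +>\<^bsub>M\<^esub> x) = k \<oplus>\<^bsub>M\<^esub> x"
      by (auto simp: a_r_coset_def')
    moreover have "h (k \<oplus>\<^bsub>M\<^esub> x) = h k \<oplus>\<^bsub>N\<^esub> h x"
      using module_homD(2)[OF assms(2) _ that] \<open>k \<in> H\<close> E(1) by blast
    ultimately show ?thesis using assms(3)[OF \<open>k \<in> H\<close>] module_homD(1)[OF assms(2) that]
      by (simp add: g_def)
  qed
  have "g \<in> module_hom K (quotient_module M H) N"
  proof (rule module_homI, unfold quotient_carrier)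
    fix X assume "X \<in> (\<lambda>x. H +>\<^bsub>M\<^esub> x) ` carrier M"
    then obtain x where x: "x \<in> carrier M" "X = H +>\<^bsub>M\<^esub> x"
      by blast
    show "g X \<in> carrier N" using x module_homD(1)[OF assms(2) x(1)] by (simp add: g)
    {
    fix Y assume "Y \<in> (\<lambda>x. H +>\<^bsub>M\<^esub> x) ` carrier M"
    then obtain y where y: "y \<in> carrier M" "Y = H +>\<^bsub>M\<^esub> y"
      by blast
    show "g (X \<oplus>\<^bsub>quotient_module M H\<^esub> Y) = g X \<oplus>\<^bsub>N\<^esub> g Y"
      unfolding x(2) y(2) quotient_add[OF x(1) y(1)] g[OF x(1)] g[OF y(1)] g[OF M.a_closed[OF x(1) y(1)]]
      by (rule module_homD(2)[OF assms(2) x(1) y(1)])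
    }
    fix a assume a: "a \<in> carrier K"
    show "g (a \<odot>\<^bsub>quotient_module M H\<^esub> X) = a \<odot>\<^bsub>N\<^esub> g X"
      unfolding x(2) quotient_smult[OF a x(1)] g[OF x(1)] g[OF M.smult_closed[OF a x(1)]]
      by (rule module_homD(3)[OF assms(2) a x(1)])
  qed
  then show ?thesis by (rule bexI[rotated]) (intro ballI g)
qed

end

context
  fixes K V W
  assumes V: "module K V" and W: "module K W"
begin

interpretation V: module K V by (rule V)
interpretation W: module K W by (rule W)

private abbreviation (input) "XX \<equiv> carrier V \<times> carrier W"
private abbreviation (input) "FF \<equiv> free_module K XX"
private abbreviation (input) "TT \<equiv> tensor_module K V W"

private lemma modF: "module K FF" by (rule free_module_module) (rule V.R.is_cring)

interpretation F: module K FF by (rule modF)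

private lemma gen_cl: "v \<in> carrier V \<Longrightarrow> w \<in> carrier W \<Longrightarrow> free_gen K XX (v, w) \<in> carrier FF"
  by (rule free_gen_carrier) (auto intro: V.R.is_cring)

private lemma rel_cl: "tensor_relations K V W \<subseteq> carrier FF"
  unfolding tensor_relations_def Let_def by (auto intro!: gen_cl F.minus_closed)

private lemma null_sub: "submodule (tensor_null K V W) K FF" "tensor_relations K V W \<subseteq> tensor_null K V W"
  unfolding tensor_null_def using submodule_span_submodule[OF modF rel_cl] by auto

lemma tensor_module_module: "module K TT"
  unfolding tensor_module_def by (rule quotient_module_module[OF modF null_sub(1)])

interpretation T: module K TT by (rule tensor_module_module)

private abbreviation (input) "q \<equiv> (\<lambda>x. tensor_null K V W +>\<^bsub>FF\<^esub> x)"

private lemma q_hom: "q \<in> module_hom K FF TT"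
  unfolding tensor_module_def by (rule quotient_hom[OF modF null_sub(1)])

private lemma q_null: "x \<in> tensor_null K V W \<Longrightarrow> q x = \<zero>\<^bsub>TT\<^esub>"
  using quotient_eq_zero_iff[OF modF null_sub(1), of x] F.submoduleE(1)[OF null_sub(1)]
  by (auto simp: tensor_module_def quotient_module_def)

private lemma q_diff:
  assumes "x \<ominus>\<^bsub>FF\<^esub> y \<in> tensor_relations K V W" "x \<in> carrier FF" "y \<in> carrier FF"
  shows "q x = q y"
proof -
  have "q (x \<ominus>\<^bsub>FF\<^esub> y) = \<zero>\<^bsub>TT\<^esub>" using assms null_sub(2) q_null by blast
  then have "q x \<ominus>\<^bsub>TT\<^esub> q y = \<zero>\<^bsub>TT\<^esub>"
    using module_hom_minus[OF modF tensor_module_module q_hom assms(2,3)] by simp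
  then show ?thesis
    by (rule T.minus_zero_imp_eq) (rule module_homD(1)[OF q_hom], fact)+
qed

private lemma pure_q: "pure_tensor K V W v w = q (free_gen K XX (v, w))"
  by (simp add: pure_tensor_def)

private lemma rels:
  "v \<in> carrier V \<Longrightarrow> v' \<in> carrier V \<Longrightarrow> w \<in> carrier W \<Longrightarrow>
    free_gen K XX (v \<oplus>\<^bsub>V\<^esub> v', w) \<ominus>\<^bsub>FF\<^esub> (free_gen K XX (v, w) \<oplus>\<^bsub>FF\<^esub> free_gen K XX (v', w)) \<in> tensor_relations K V W"
  "v \<in> carrier V \<Longrightarrow> w \<in> carrier W \<Longrightarrow> w' \<in> carrier W \<Longrightarrow>
    free_gen K XX (v, w \<oplus>\<^bsub>W\<^esub> w') \<ominus>\<^bsub>FF\<^esub> (free_gen K XX (v, w) \<oplus>\<^bsub>FF\<^esub> free_gen K XX (v, w')) \<in> tensor_relations K V W"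
  "a \<in> carrier K \<Longrightarrow> v \<in> carrier V \<Longrightarrow> w \<in> carrier W \<Longrightarrow>
    free_gen K XX (a \<odot>\<^bsub>V\<^esub> v, w) \<ominus>\<^bsub>FF\<^esub> (a \<odot>\<^bsub>FF\<^esub> free_gen K XX (v, w)) \<in> tensor_relations K V W"
  "a \<in> carrier K \<Longrightarrow> v \<in> carrier V \<Longrightarrow> w \<in> carrier W \<Longrightarrow>
    free_gen K XX (v, a \<odot>\<^bsub>W\<^esub> w) \<ominus>\<^bsub>FF\<^esub> (a \<odot>\<^bsub>FF\<^esub> free_gen K XX (v, w)) \<in> tensor_relations K V W"
  unfolding tensor_relations_def Let_def by blast+

lemma pure_tensor_bilinear: "bilinear_on K V W TT (pure_tensor K V W)"
  unfolding bilinear_on_def pure_q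
proof (intro conjI ballI)
  fix v w assume vw: "v \<in> carrier V" "w \<in> carrier W"
  show "q (free_gen K XX (v, w)) \<in> carrier TT" by (rule module_homD(1)[OF q_hom gen_cl[OF vw]])
  {
    fix v' assume v': "v' \<in> carrier V"
    have "q (free_gen K XX (v \<oplus>\<^bsub>V\<^esub> v', w)) = q (free_gen K XX (v, w) \<oplus>\<^bsub>FF\<^esub> free_gen K XX (v', w))"
      by (rule q_diff[OF rels(1)]) (auto simp: vw v' gen_cl)
    then show "q (free_gen K XX (v \<oplus>\<^bsub>V\<^esub> v', w)) = q (free_gen K XX (v, w)) \<oplus>\<^bsub>TT\<^esub> q (free_gen K XX (v', w))"
      using module_homD(2)[OF q_hom] gen_cl vw v' by simp
  }
  {
    fix w' assume w': "w' \<in> carrier W"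
    have "q (free_gen K XX (v, w \<oplus>\<^bsub>W\<^esub> w')) = q (free_gen K XX (v, w) \<oplus>\<^bsub>FF\<^esub> free_gen K XX (v, w'))"
      by (rule q_diff[OF rels(2)]) (auto simp: vw w' gen_cl)
    then show "q (free_gen K XX (v, w \<oplus>\<^bsub>W\<^esub> w')) = q (free_gen K XX (v, w)) \<oplus>\<^bsub>TT\<^esub> q (free_gen K XX (v, w'))"
      using module_homD(2)[OF q_hom] gen_cl vw w' by simp
  }
next
  fix a v w assume vw: "a \<in> carrier K" "v \<in> carrier V" "w \<in> carrier W"
  have "q (free_gen K XX (a \<odot>\<^bsub>V\<^esub> v, w)) = q (a \<odot>\<^bsub>FF\<^esub> free_gen K XX (v, w))"
    by (rule q_diff[OF rels(3)]) (auto simp: vw gen_cl)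
  then show "q (free_gen K XX (a \<odot>\<^bsub>V\<^esub> v, w)) = a \<odot>\<^bsub>TT\<^esub> q (free_gen K XX (v, w))"
    using module_homD(3)[OF q_hom] gen_cl vw by simp
  have "q (free_gen K XX (v, a \<odot>\<^bsub>W\<^esub> w)) = q (a \<odot>\<^bsub>FF\<^esub> free_gen K XX (v, w))"
    by (rule q_diff[OF rels(4)]) (auto simp: vw gen_cl)
  then show "q (free_gen K XX (v, a \<odot>\<^bsub>W\<^esub> w)) = a \<odot>\<^bsub>TT\<^esub> q (free_gen K XX (v, w))"
    using module_homD(3)[OF q_hom] gen_cl vw by simp
qed

lemma tensor_hom_eqI:
  assumes M: "module K M" and h: "h \<in> module_hom K TT M" and g: "g \<in> module_hom K TT M"
    and eq: "\<And>v w. v \<in> carrier V \<Longrightarrow> w \<in> carrier W \<Longrightarrow> h (pure_tensor K V W v w) = g (pure_tensor K V W v w)"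
    and t: "t \<in> carrier TT"
  shows "h t = g t"
proof -
  interpret M: module K M by fact
  let ?H = "{f \<in> carrier FF. h (q f) = g (q f)}"
  note D = module_homD[OF h] module_homD[OF g] module_homD[OF q_hom]
  have neg: "\<ominus>\<^bsub>FF\<^esub> f = (\<ominus>\<^bsub>K\<^esub> \<one>\<^bsub>K\<^esub>) \<odot>\<^bsub>FF\<^esub> f" if "f \<in> carrier FF" for f
    using that by (simp add: F.smult_l_minus)
  have zr: "\<zero>\<^bsub>FF\<^esub> = \<zero>\<^bsub>K\<^esub> \<odot>\<^bsub>FF\<^esub> \<zero>\<^bsub>FF\<^esub>" by simp
  have "submodule ?H K FF"
  proof (rule F.submoduleI)
    show "\<zero>\<^bsub>FF\<^esub> \<in> ?H"
      using module_hom_zero[OF modF tensor_module_module q_hom]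
        module_hom_zero[OF tensor_module_module M h] module_hom_zero[OF tensor_module_module M g]
      by simp
    show "\<ominus>\<^bsub>FF\<^esub> a \<in> ?H" if "a \<in> ?H" for a using that by (simp add: neg D)
  qed (auto simp: D)
  moreover obtain f where "f \<in> carrier FF" "t = q f"
    using t quotient_carrier[OF modF null_sub(1)] by (auto simp: tensor_module_def)
  ultimately show ?thesis
    using free_submodule_all[OF V.R.is_cring, of ?H XX f] gen_cl eq by (auto simp: pure_q)
qed

lemma tensor_lift_ex:
  assumes M: "module K M" and b: "bilinear_on K V W M b"
  shows "\<exists>h\<in>module_hom K TT M. \<forall>v\<in>carrier V. \<forall>w\<in>carrier W. h (pure_tensor K V W v w) = b v w"
proof -
  interpret M: module K M by fact
  have "\<exists>h\<in>module_hom K FF M. \<forall>x\<in>XX. h (free_gen K XX x) = (\<lambda>(v, w). b v w) x"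
    by (rule free_ext[OF M]) (use b in \<open>auto simp: bilinear_on_def\<close>)
  then obtain h where h: "h \<in> module_hom K FF M"
    and hb: "\<And>v w. v \<in> carrier V \<Longrightarrow> w \<in> carrier W \<Longrightarrow> h (free_gen K XX (v, w)) = b v w" by auto
  let ?H = "{x \<in> carrier FF. h x = \<zero>\<^bsub>M\<^esub>}"
  have hm: "h (x \<ominus>\<^bsub>FF\<^esub> y) = \<zero>\<^bsub>M\<^esub>" if "x \<in> carrier FF" "y \<in> carrier FF" "h x = h y" for x y
    using module_hom_minus[OF modF M h that(1,2)] that module_homD(1)[OF h]
    by (simp add: a_minus_def M.r_neg)
  have "tensor_relations K V W \<subseteq> ?H"
    unfolding tensor_relations_def Let_def
    using b by (auto intro!: hm simp: gen_cl module_homD[OF h] hb bilinear_on_def)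
  then have "tensor_null K V W \<subseteq> ?H" unfolding tensor_null_def
    by (rule submodule_span_least[OF submodule_kernel[OF modF M h]])
  then have "\<exists>g\<in>module_hom K TT M. \<forall>x\<in>carrier FF. g (q x) = h x"
    unfolding tensor_module_def
    by (intro quotient_lift[OF modF null_sub(1) M h]) auto
  then obtain g where g: "g \<in> module_hom K TT M" "\<And>x. x \<in> carrier FF \<Longrightarrow> g (q x) = h x" by blast
  show ?thesis by (rule bexI[OF _ g(1)]) (auto simp: pure_q g(2) gen_cl hb)
qed

lemma tensor_lift_unique_exists:
  assumes M: "module K M" and b: "bilinear_on K V W M b"
  shows "\<exists>!h. h \<in> module_hom K TT M \<and> h \<in> extensional (carrier TT) \<and>
            (\<forall>v\<in>carrier V. \<forall>w\<in>carrier W. h (pure_tensor K V W v w) = b v w)"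
proof -
  obtain h where h: "h\<in>module_hom K TT M"
    "\<And>v w. v\<in>carrier V \<Longrightarrow> w\<in>carrier W \<Longrightarrow> h (pure_tensor K V W v w) = b v w"
    using tensor_lift_ex[OF assms] by blast
  have pc: "pure_tensor K V W v w \<in> carrier TT" if "v\<in>carrier V" "w\<in>carrier W" for v w
    using pure_tensor_bilinear that by (auto simp: bilinear_on_def)
  show ?thesis
  proof (rule ex1I[of _ "restrict h (carrier TT)"], intro conjI)
    show "restrict h (carrier TT) \<in> module_hom K TT M"
      using h(1) by (auto intro!: module_homI simp: module_homD)
    fix g assume g: "g \<in> module_hom K TT M \<and> g \<in> extensional (carrier TT) \<and>
            (\<forall>v\<in>carrier V. \<forall>w\<in>carrier W. g (pure_tensor K V W v w) = b v w)"
    show "g = restrict h (carrier TT)"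
      by (rule extensionalityI[of _ "carrier TT"])
        (use g h tensor_hom_eqI[OF M _ h(1), of g] in auto)
  qed (auto simp: pc h)
qed

lemma tensor_lift:
  assumes M: "module K M" and b: "bilinear_on K V W M b"
  shows "tensor_lift K V W M b \<in> module_hom K TT M"
    and "v \<in> carrier V \<Longrightarrow> w \<in> carrier W \<Longrightarrow> tensor_lift K V W M b (pure_tensor K V W v w) = b v w"
  using theI'[OF tensor_lift_unique_exists[OF assms]] unfolding tensor_lift_def by auto

end

lemma bilinear_onD:
  assumes "bilinear_on K V W M b"
  shows "v \<in> carrier V \<Longrightarrow> w \<in> carrier W \<Longrightarrow> b v w \<in> carrier M"
    and "v \<in> carrier V \<Longrightarrow> v' \<in> carrier V \<Longrightarrow> w \<in> carrier W \<Longrightarrow> b (v \<oplus>\<^bsub>V\<^esub> v') w = b v w \<oplus>\<^bsub>M\<^esub> b v' w"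
    and "v \<in> carrier V \<Longrightarrow> w \<in> carrier W \<Longrightarrow> w' \<in> carrier W \<Longrightarrow> b v (w \<oplus>\<^bsub>W\<^esub> w') = b v w \<oplus>\<^bsub>M\<^esub> b v w'"
    and "a \<in> carrier K \<Longrightarrow> v \<in> carrier V \<Longrightarrow> w \<in> carrier W \<Longrightarrow> b (a \<odot>\<^bsub>V\<^esub> v) w = a \<odot>\<^bsub>M\<^esub> b v w"
    and "a \<in> carrier K \<Longrightarrow> v \<in> carrier V \<Longrightarrow> w \<in> carrier W \<Longrightarrow> b v (a \<odot>\<^bsub>W\<^esub> w) = a \<odot>\<^bsub>M\<^esub> b v w"
  using assms unfolding bilinear_on_def by blast+

lemma bilinear_onI:
  assumes "\<And>v w. v \<in> carrier V \<Longrightarrow> w \<in> carrier W \<Longrightarrow> b v w \<in> carrier M"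
    and "\<And>v v' w. v \<in> carrier V \<Longrightarrow> v' \<in> carrier V \<Longrightarrow> w \<in> carrier W \<Longrightarrow> b (v \<oplus>\<^bsub>V\<^esub> v') w = b v w \<oplus>\<^bsub>M\<^esub> b v' w"
    and "\<And>v w w'. v \<in> carrier V \<Longrightarrow> w \<in> carrier W \<Longrightarrow> w' \<in> carrier W \<Longrightarrow> b v (w \<oplus>\<^bsub>W\<^esub> w') = b v w \<oplus>\<^bsub>M\<^esub> b v w'"
    and "\<And>a v w. a \<in> carrier K \<Longrightarrow> v \<in> carrier V \<Longrightarrow> w \<in> carrier W \<Longrightarrow> b (a \<odot>\<^bsub>V\<^esub> v) w = a \<odot>\<^bsub>M\<^esub> b v w"
    and "\<And>a v w. a \<in> carrier K \<Longrightarrow> v \<in> carrier V \<Longrightarrow> w \<in> carrier W \<Longrightarrow> b v (a \<odot>\<^bsub>W\<^esub> w) = a \<odot>\<^bsub>M\<^esub> b v w"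
  shows "bilinear_on K V W M b"
  using assms unfolding bilinear_on_def by blast

lemma bilinear_left_hom: "bilinear_on K V W M b \<Longrightarrow> w \<in> carrier W \<Longrightarrow> (\<lambda>v. b v w) \<in> module_hom K V M"
  by (rule module_homI) (simp_all add: bilinear_onD)

lemma bilinear_right_hom: "bilinear_on K V W M b \<Longrightarrow> v \<in> carrier V \<Longrightarrow> (\<lambda>w. b v w) \<in> module_hom K W M"
  by (rule module_homI) (simp_all add: bilinear_onD)

lemma module_hom_comp: "f \<in> module_hom K M N \<Longrightarrow> g \<in> module_hom K N L \<Longrightarrow> (\<lambda>x. g (f x)) \<in> module_hom K M L"
  by (rule module_homI) (simp_all add: module_homD)

lemma module_hom_id: "(\<lambda>x. x) \<in> module_hom K M M"
  by (rule module_homI) auto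

lemma module_hom_add:
  assumes "module K N" "f \<in> module_hom K M N" "g \<in> module_hom K M N"
  shows "(\<lambda>x. f x \<oplus>\<^bsub>N\<^esub> g x) \<in> module_hom K M N"
proof -
  interpret N: module K N by fact
  note D = module_homD[OF assms(2)] module_homD[OF assms(3)]
  show ?thesis by (rule module_homI) (simp_all add: D N.a_ac N.smult_r_distr)
qed

lemma module_hom_smult:
  assumes "module K N" "f \<in> module_hom K M N" "a \<in> carrier K"
  shows "(\<lambda>x. a \<odot>\<^bsub>N\<^esub> f x) \<in> module_hom K M N"
proof -
  interpret N: module K N by fact
  note D = module_homD[OF assms(2)]
  have c: "a \<odot>\<^bsub>N\<^esub> (b \<odot>\<^bsub>N\<^esub> x) = b \<odot>\<^bsub>N\<^esub> (a \<odot>\<^bsub>N\<^esub> x)" if "b \<in> carrier K" "x \<in> carrier N" for b x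
    using that assms(3) N.smult_assoc1[symmetric] N.R.m_comm by simp
  show ?thesis by (rule module_homI) (simp_all add: D N.smult_r_distr assms(3) c)
qed

lemma bilinear_comp:
  assumes "bilinear_on K V W M b" "f \<in> module_hom K V' V" "g \<in> module_hom K W' W" "h \<in> module_hom K M N"
  shows "bilinear_on K V' W' N (\<lambda>v w. h (b (f v) (g w)))"
  by (rule bilinear_onI)
    (simp_all add: bilinear_onD[OF assms(1)] module_homD[OF assms(2)] module_homD[OF assms(3)] module_homD[OF assms(4)])

lemma tensor_map:
  assumes "module K V" "module K W" "module K V'" "module K W'"
    "f \<in> module_hom K V V'" "g \<in> module_hom K W W'"
  shows "tensor_map K V W V' W' f g \<in> module_hom K (tensor_module K V W) (tensor_module K V' W')"
    and "v \<in> carrier V \<Longrightarrow> w \<in> carrier W \<Longrightarrow>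
      tensor_map K V W V' W' f g (pure_tensor K V W v w) = pure_tensor K V' W' (f v) (g w)"
proof -
  have b: "bilinear_on K V W (tensor_module K V' W') (\<lambda>v w. pure_tensor K V' W' (f v) (g w))"
    by (rule bilinear_comp[OF pure_tensor_bilinear[OF assms(3,4)] assms(5,6) module_hom_id])
  note L = tensor_lift[OF assms(1,2) tensor_module_module[OF assms(3,4)] b]
  show "tensor_map K V W V' W' f g \<in> module_hom K (tensor_module K V W) (tensor_module K V' W')"
    "v \<in> carrier V \<Longrightarrow> w \<in> carrier W \<Longrightarrow>
      tensor_map K V W V' W' f g (pure_tensor K V W v w) = pure_tensor K V' W' (f v) (g w)"
    unfolding tensor_map_def by (rule L(1)) (rule L(2))
qed

context
  fixes K U V W
  assumes U: "module K U" and V: "module K V" and W: "module K W"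
begin

private abbreviation (input) "UV \<equiv> tensor_module K U V"
private abbreviation (input) "VW \<equiv> tensor_module K V W"
private abbreviation (input) "LL \<equiv> tensor_module K UV W"
private abbreviation (input) "RR \<equiv> tensor_module K U VW"
private abbreviation (input) "pl u v w \<equiv> pure_tensor K UV W (pure_tensor K U V u v) w"
private abbreviation (input) "pr u v w \<equiv> pure_tensor K U VW u (pure_tensor K V W v w)"

private lemma mUV: "module K UV" and mVW: "module K VW" and mLL: "module K LL" and mRR: "module K RR"
  by (intro tensor_module_module U V W)+

private lemmas bUV = pure_tensor_bilinear[OF U V]
private lemmas bVW = pure_tensor_bilinear[OF V W]
private lemmas bLL = pure_tensor_bilinear[OF mUV W]
private lemmas bRR = pure_tensor_bilinear[OF U mVW]

lemma tensor_left_eqI: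
  assumes M: "module K M" and h: "h \<in> module_hom K LL M" and g: "g \<in> module_hom K LL M"
    and eq: "\<And>u v w. u \<in> carrier U \<Longrightarrow> v \<in> carrier V \<Longrightarrow> w \<in> carrier W \<Longrightarrow> h (pl u v w) = g (pl u v w)"
    and t: "t \<in> carrier LL"
  shows "h t = g t"
proof (rule tensor_hom_eqI[OF mUV W M h g _ t])
  fix s w assume s: "s \<in> carrier UV" and w: "w \<in> carrier W"
  show "h (pure_tensor K UV W s w) = g (pure_tensor K UV W s w)"
    by (rule tensor_hom_eqI[OF U V M module_hom_comp[OF bilinear_left_hom[OF bLL w] h]
        module_hom_comp[OF bilinear_left_hom[OF bLL w] g] _ s]) (rule eq[OF _ _ w])
qed

lemma tensor_right_eqI:
  assumes M: "module K M" and h: "h \<in> module_hom K RR M" and g: "g \<in> module_hom K RR M"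
    and eq: "\<And>u v w. u \<in> carrier U \<Longrightarrow> v \<in> carrier V \<Longrightarrow> w \<in> carrier W \<Longrightarrow> h (pr u v w) = g (pr u v w)"
    and t: "t \<in> carrier RR"
  shows "h t = g t"
proof (rule tensor_hom_eqI[OF U mVW M h g _ t])
  fix s u assume s: "s \<in> carrier VW" and u: "u \<in> carrier U"
  show "h (pure_tensor K U VW u s) = g (pure_tensor K U VW u s)"
    by (rule tensor_hom_eqI[OF V W M module_hom_comp[OF bilinear_right_hom[OF bRR u] h]
        module_hom_comp[OF bilinear_right_hom[OF bRR u] g] _ s]) (rule eq[OF u])
qed

interpretation LL: module K LL by (rule mLL)
interpretation RR: module K RR by (rule mRR)

private abbreviation (input) "al w \<equiv> tensor_lift K U V RR (\<lambda>u v. pr u v w)"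
private abbreviation (input) "be u \<equiv> tensor_lift K V W LL (\<lambda>v w. pl u v w)"

private lemma bil_al: "w \<in> carrier W \<Longrightarrow> bilinear_on K U V RR (\<lambda>u v. pr u v w)"
  by (rule bilinear_comp[OF bRR module_hom_id bilinear_left_hom[OF bVW] module_hom_id])

private lemma bil_be: "u \<in> carrier U \<Longrightarrow> bilinear_on K V W LL (\<lambda>v w. pl u v w)"
  by (rule bilinear_comp[OF bLL bilinear_right_hom[OF bUV] module_hom_id module_hom_id])

private lemmas al = tensor_lift[OF U V mRR bil_al]
private lemmas be = tensor_lift[OF V W mLL bil_be]

private lemma W_closed: "w \<in> carrier W \<Longrightarrow> w' \<in> carrier W \<Longrightarrow> w \<oplus>\<^bsub>W\<^esub> w' \<in> carrier W"
  "a \<in> carrier K \<Longrightarrow> w \<in> carrier W \<Longrightarrow> a \<odot>\<^bsub>W\<^esub> w \<in> carrier W"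
  "u \<in> carrier U \<Longrightarrow> u' \<in> carrier U \<Longrightarrow> u \<oplus>\<^bsub>U\<^esub> u' \<in> carrier U"
  "a \<in> carrier K \<Longrightarrow> u \<in> carrier U \<Longrightarrow> a \<odot>\<^bsub>U\<^esub> u \<in> carrier U"
  using W U by (auto simp: module_def abelian_group_def intro!: abelian_monoid.a_closed module.smult_closed[OF W] module.smult_closed[OF U])

private lemma bil_al2: "bilinear_on K UV W RR (\<lambda>t w. al w t)"
proof (rule bilinear_onI)
  fix t w assume t: "t \<in> carrier UV" and w: "w \<in> carrier W"
  show "al w t \<in> carrier RR" by (rule module_homD(1)[OF al(1)[OF w] t])
  {
    fix t' assume t': "t' \<in> carrier UV"
    show "al w (t \<oplus>\<^bsub>UV\<^esub> t') = al w t \<oplus>\<^bsub>RR\<^esub> al w t'" by (rule module_homD(2)[OF al(1)[OF w] t t'])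
  }
  {
    fix w' assume w': "w' \<in> carrier W"
    show "al (w \<oplus>\<^bsub>W\<^esub> w') t = al w t \<oplus>\<^bsub>RR\<^esub> al w' t"
      by (rule tensor_hom_eqI[OF U V mRR al(1) module_hom_add[OF mRR al(1) al(1)] _ t])
        (simp_all add: W_closed w w' al(2) bilinear_onD[OF bVW] bilinear_onD[OF bRR])
  }
next
  fix a t w assume a: "a \<in> carrier K" and t: "t \<in> carrier UV" and w: "w \<in> carrier W"
  show "al w (a \<odot>\<^bsub>UV\<^esub> t) = a \<odot>\<^bsub>RR\<^esub> al w t" by (rule module_homD(3)[OF al(1)[OF w] a t])
  show "al (a \<odot>\<^bsub>W\<^esub> w) t = a \<odot>\<^bsub>RR\<^esub> al w t"
    by (rule tensor_hom_eqI[OF U V mRR al(1) module_hom_smult[OF mRR al(1)] _ t])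
      (simp_all add: W_closed a w al(2) bilinear_onD[OF bVW] bilinear_onD[OF bRR])
qed

private lemma bil_be2: "bilinear_on K U VW LL (\<lambda>u t. be u t)"
proof (rule bilinear_onI)
  fix t u assume t: "t \<in> carrier VW" and u: "u \<in> carrier U"
  show "be u t \<in> carrier LL" by (rule module_homD(1)[OF be(1)[OF u] t])
  {
    fix t' assume t': "t' \<in> carrier VW"
    show "be u (t \<oplus>\<^bsub>VW\<^esub> t') = be u t \<oplus>\<^bsub>LL\<^esub> be u t'" by (rule module_homD(2)[OF be(1)[OF u] t t'])
  }
  {
    fix u' assume u': "u' \<in> carrier U"
    show "be (u \<oplus>\<^bsub>U\<^esub> u') t = be u t \<oplus>\<^bsub>LL\<^esub> be u' t"
      by (rule tensor_hom_eqI[OF V W mLL be(1) module_hom_add[OF mLL be(1) be(1)] _ t])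
        (simp_all add: W_closed u u' be(2) bilinear_onD[OF bUV] bilinear_onD[OF bLL])
  }
next
  fix a u t assume a: "a \<in> carrier K" and t: "t \<in> carrier VW" and u: "u \<in> carrier U"
  show "be u (a \<odot>\<^bsub>VW\<^esub> t) = a \<odot>\<^bsub>LL\<^esub> be u t" by (rule module_homD(3)[OF be(1)[OF u] a t])
  show "be (a \<odot>\<^bsub>U\<^esub> u) t = a \<odot>\<^bsub>LL\<^esub> be u t"
    by (rule tensor_hom_eqI[OF V W mLL be(1) module_hom_smult[OF mLL be(1)] _ t])
      (simp_all add: W_closed a u be(2) bilinear_onD[OF bUV] bilinear_onD[OF bLL])
qed

lemma tensor_assoc_hom: "tensor_assoc K U V W \<in> module_hom K LL RR"
  unfolding tensor_assoc_def by (rule tensor_lift(1)[OF mUV W mRR bil_al2])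

lemma tensor_assoc_pure:
  "u \<in> carrier U \<Longrightarrow> v \<in> carrier V \<Longrightarrow> w \<in> carrier W \<Longrightarrow> tensor_assoc K U V W (pl u v w) = pr u v w"
  unfolding tensor_assoc_def using tensor_lift(2)[OF mUV W mRR bil_al2, of "pure_tensor K U V u v" w]
  by (simp add: bilinear_onD(1)[OF bUV] al(2))

lemma tensor_assoc_inverse:
  obtains \<beta> where "\<beta> \<in> module_hom K RR LL"
    "\<And>t. t \<in> carrier LL \<Longrightarrow> \<beta> (tensor_assoc K U V W t) = t"
    "\<And>t. t \<in> carrier RR \<Longrightarrow> tensor_assoc K U V W (\<beta> t) = t"
proof -
  define \<beta> where "\<beta> = tensor_lift K U VW LL (\<lambda>u t. be u t)"
  have h: "\<beta> \<in> module_hom K RR LL" unfolding \<beta>_def by (rule tensor_lift(1)[OF U mVW mLL bil_be2])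
  have p: "\<beta> (pr u v w) = pl u v w" if "u \<in> carrier U" "v \<in> carrier V" "w \<in> carrier W" for u v w
    unfolding \<beta>_def using that tensor_lift(2)[OF U mVW mLL bil_be2, of u "pure_tensor K V W v w"]
    by (simp add: bilinear_onD(1)[OF bVW] be(2))
  show ?thesis
  proof (rule that[OF h])
    show "\<beta> (tensor_assoc K U V W t) = t" if "t \<in> carrier LL" for t
      by (rule tensor_left_eqI[OF mLL module_hom_comp[OF tensor_assoc_hom h] module_hom_id _ that])
        (simp add: tensor_assoc_pure p)
    show "tensor_assoc K U V W (\<beta> t) = t" if "t \<in> carrier RR" for t
      by (rule tensor_right_eqI[OF mRR module_hom_comp[OF h tensor_assoc_hom] module_hom_id _ that])
        (simp add: tensor_assoc_pure p)
  qed
qed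

lemma tensor_assoc_bij: "bij_betw (tensor_assoc K U V W) (carrier LL) (carrier RR)"
proof -
  obtain \<beta> where b: "\<beta> \<in> module_hom K RR LL"
    "\<And>t. t \<in> carrier LL \<Longrightarrow> \<beta> (tensor_assoc K U V W t) = t"
    "\<And>t. t \<in> carrier RR \<Longrightarrow> tensor_assoc K U V W (\<beta> t) = t" using tensor_assoc_inverse by blast
  show ?thesis
    by (rule bij_betw_byWitness[of _ \<beta>]) (auto simp: b module_homD(1)[OF b(1)] module_homD(1)[OF tensor_assoc_hom])
qed

lemma tensor_assoc_inv_hom: "inv_into (carrier LL) (tensor_assoc K U V W) \<in> module_hom K RR LL"
proof -
  obtain \<beta> where b: "\<beta> \<in> module_hom K RR LL"
    "\<And>t. t \<in> carrier LL \<Longrightarrow> \<beta> (tensor_assoc K U V W t) = t"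
    "\<And>t. t \<in> carrier RR \<Longrightarrow> tensor_assoc K U V W (\<beta> t) = t" using tensor_assoc_inverse by blast
  have eq: "inv_into (carrier LL) (tensor_assoc K U V W) t = \<beta> t" if "t \<in> carrier RR" for t
    using inv_into_f_f[OF bij_betw_imp_inj_on[OF tensor_assoc_bij], of "\<beta> t"] b(3)[OF that] module_homD(1)[OF b(1) that] by simp
  show ?thesis
    by (rule module_homI) (simp_all add: eq module_homD[OF b(1)])
qed

end

end

theory Submission
  imports Defs
begin

text \<open>
  On \<open>V = k \<oplus> g\<close> put \<open>e = (1, 0)\<close> and \<open>[(a, x), (b, y)] = (0, [x, y])\<close>, so that
  \<open>S (u \<otimes> v) = v \<otimes> u + [u, v] \<otimes> e\<close> with \<open>e\<close> central.  Expanding the Yang--Baxter equation on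
  \<open>u \<otimes> v \<otimes> w\<close>, all terms match except for those of the form \<open>_ \<otimes> e \<otimes> e\<close>, whose equality is the
  Jacobi identity.  The averaging condition for \<open>A\<close> at \<open>(a, x)\<close>, \<open>(b, y)\<close> reduces to
  \<open>(0, [P x, P y]) \<otimes> e = (0, P [P x, y]) \<otimes> e\<close>, and \<open>z \<mapsto> (0, z) \<otimes> e\<close> is injective because
  \<open>(a, x) \<otimes> (b, y) \<mapsto> b x\<close> is a left inverse.
\<close>

section \<open>Direct sums of modules and sums of bilinear maps\<close>

lemma ring_as_module_module:
  assumes "cring K" shows "module K (ring_as_module K)"
proof -
  interpret cring K by fact
  show ?thesis
  proof (rule moduleI)
    show "abelian_group (ring_as_module K)"
      by (rule abelian_groupI)
        (auto simp: ring_as_module_def a_ac intro!: bexI[of _ "\<ominus>\<^bsub>K\<^esub> _"] l_neg)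
  qed (auto simp: ring_as_module_def m_assoc l_distr r_distr is_cring)
qed

lemma direct_sum_module:
  assumes "module K M" "module K N" shows "module K (direct_sum M N)"
proof -
  interpret M: module K M by fact
  interpret N: module K N by fact
  show ?thesis
  proof (rule moduleI)
    show "abelian_group (direct_sum M N)"
    proof (rule abelian_groupI)
      fix z assume z: "z \<in> carrier (direct_sum M N)"
      then show "\<exists>z'\<in>carrier (direct_sum M N). z' \<oplus>\<^bsub>direct_sum M N\<^esub> z = \<zero>\<^bsub>direct_sum M N\<^esub>"
        by (intro bexI[of _ "(\<ominus>\<^bsub>M\<^esub> fst z, \<ominus>\<^bsub>N\<^esub> snd z)"])
          (auto simp: direct_sum_def M.l_neg N.l_neg)
    qed (auto simp: direct_sum_def M.a_ac N.a_ac)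
  qed (auto simp: direct_sum_def M.R.is_cring M.smult_l_distr N.smult_l_distr M.smult_r_distr
      N.smult_r_distr M.smult_assoc1 N.smult_assoc1)
qed

lemma bilinear_swap: "bilinear_on K V W M b \<Longrightarrow> bilinear_on K W V M (\<lambda>w v. b v w)"
  by (rule bilinear_onI) (simp_all add: bilinear_onD)

lemma bilinear_add:
  assumes "module K M" "bilinear_on K V W M b" "bilinear_on K V W M c"
  shows "bilinear_on K V W M (\<lambda>v w. b v w \<oplus>\<^bsub>M\<^esub> c v w)"
proof -
  interpret M: module K M by fact
  show ?thesis
    by (rule bilinear_onI)
      (simp_all add: bilinear_onD[OF assms(2)] bilinear_onD[OF assms(3)] M.a_ac M.smult_r_distr)
qed

lemma pure_tensor_zero_left:
  assumes "module K V" "module K W" "w \<in> carrier W"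
  shows "pure_tensor K V W \<zero>\<^bsub>V\<^esub> w = \<zero>\<^bsub>tensor_module K V W\<^esub>"
  by (rule module_hom_zero[OF assms(1) tensor_module_module[OF assms(1,2)]
      bilinear_left_hom[OF pure_tensor_bilinear[OF assms(1,2)] assms(3)]])

section \<open>\<open>id_tensor\<close> and \<open>tensor_id\<close> evaluated on pure
  tensors\<close>

context
  fixes K V S
  assumes V: "module K V" and S: "S \<in> module_hom K (tensor_module K V V) (tensor_module K V V)"
begin

private lemmas VV = tensor_module_module[OF V V]
private lemmas pure_closed = bilinear_onD(1)[OF pure_tensor_bilinear[OF V V]]

lemma id_tensor_hom:
  "id_tensor K V S \<in> module_hom K (tensor_module K V (tensor_module K V V))
    (tensor_module K V (tensor_module K V V))"
  unfolding id_tensor_def by (rule tensor_map(1)[OF V VV V VV module_hom_id S])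

lemma id_tensor_pure:
  "u \<in> carrier V \<Longrightarrow> t \<in> carrier (tensor_module K V V) \<Longrightarrow>
    id_tensor K V S (pure_tensor K V (tensor_module K V V) u t) =
    pure_tensor K V (tensor_module K V V) u (S t)"
  unfolding id_tensor_def by (rule tensor_map(2)[OF V VV V VV module_hom_id S])

lemma tensor_id_hom:
  "tensor_id K V S \<in> module_hom K (tensor_module K V (tensor_module K V V))
    (tensor_module K V (tensor_module K V V))"
  unfolding tensor_id_def
  by (rule module_hom_comp[OF module_hom_comp[OF tensor_assoc_inv_hom[OF V V V]
        tensor_map(1)[OF VV V VV V S module_hom_id]] tensor_assoc_hom[OF V V V]])

text \<open>The right-bracketed tensor is the image under \<open>tensor_assoc\<close> of a
  left-bracketed one, so injectivity cancels the inverse. The outer \<open>tensor_assoc\<close>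
  stays because \<open>S (pure_tensor K V V u v)\<close> is in general not pure.\<close>

lemma tensor_id_pure:
  assumes "u \<in> carrier V" "v \<in> carrier V" "w \<in> carrier V"
  shows "tensor_id K V S (pure_tensor K V (tensor_module K V V) u (pure_tensor K V V v w)) =
    tensor_assoc K V V V (pure_tensor K (tensor_module K V V) V (S (pure_tensor K V V u v)) w)"
proof -
  let ?l = "pure_tensor K (tensor_module K V V) V (pure_tensor K V V u v) w"
  let ?L = "carrier (tensor_module K (tensor_module K V V) V)"
  have "?l \<in> ?L"
    using assms by (intro bilinear_onD(1)[OF pure_tensor_bilinear[OF VV V]] pure_closed)
  then have "inv_into ?L (tensor_assoc K V V V) (tensor_assoc K V V V ?l) = ?l"
    by (intro inv_into_f_f bij_betw_imp_inj_on[OF tensor_assoc_bij[OF V V V]])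
  then show ?thesis
    unfolding tensor_id_def tensor_assoc_pure[OF V V V assms, symmetric]
    using assms by (simp add: tensor_map(2)[OF VV V VV V S module_hom_id] pure_closed)
qed

end

section \<open>Notation on \<open>k \<oplus> g\<close> and bracket identities\<close>

context lie_algebra
begin

abbreviation (input) "V \<equiv> lie_braided_space K G"
abbreviation (input) "V2 \<equiv> tensor_module K V V"
abbreviation (input) "V3 \<equiv> tensor_module K V V2"
abbreviation (input) "S \<equiv> lie_braiding K G bracket"
abbreviation (input) "e \<equiv> (\<one>\<^bsub>K\<^esub>, \<zero>\<^bsub>G\<^esub>)"
abbreviation (input) "br u v \<equiv> (\<zero>\<^bsub>K\<^esub>, bracket (snd u) (snd v))"
abbreviation (input) "pure2 \<equiv> pure_tensor K V V"
abbreviation (input) "pure3 u v w \<equiv> pure_tensor K V V2 u (pure2 v w)"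

lemma lie_braided_space_simps:
  "carrier V = carrier K \<times> carrier G"
  "\<zero>\<^bsub>V\<^esub> = (\<zero>\<^bsub>K\<^esub>, \<zero>\<^bsub>G\<^esub>)"
  "u \<oplus>\<^bsub>V\<^esub> v = (fst u \<oplus>\<^bsub>K\<^esub> fst v, snd u \<oplus>\<^bsub>G\<^esub> snd v)"
  "a \<odot>\<^bsub>V\<^esub> u = (a \<otimes>\<^bsub>K\<^esub> fst u, a \<odot>\<^bsub>G\<^esub> snd u)"
  by (simp_all add: lie_braided_space_def direct_sum_def ring_as_module_def split_beta)

lemma lie_braided_space_module: "module K V"
  unfolding lie_braided_space_def
  by (intro direct_sum_module ring_as_module_module is_cring module_axioms)

lemma bracket_zero:
  assumes "x \<in> carrier G"
  shows "bracket \<zero>\<^bsub>G\<^esub> x = \<zero>\<^bsub>G\<^esub>" "bracket x \<zero>\<^bsub>G\<^esub> = \<zero>\<^bsub>G\<^esub>"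
  \<comment> \<open>The zero vector is the zero scalar times itself, so homogeneity of the bracket
    applies.\<close>
  using bracket_smult_left[of "\<zero>\<^bsub>K\<^esub>" "\<zero>\<^bsub>G\<^esub>" x] bracket_smult_right[of "\<zero>\<^bsub>K\<^esub>" x "\<zero>\<^bsub>G\<^esub>"] assms
  by (simp_all add: bracket_closed)

text \<open>Polarization: the alternating law at the sum of \<open>x\<close> and \<open>y\<close>
  leaves only the two mixed brackets.\<close>

lemma bracket_anticomm:
  assumes "x \<in> carrier G" "y \<in> carrier G"
  shows "bracket y x = \<ominus>\<^bsub>G\<^esub> bracket x y"
proof -
  have "bracket y x \<oplus>\<^bsub>G\<^esub> bracket x y = \<zero>\<^bsub>G\<^esub>"
    using bracket_self[of "x \<oplus>\<^bsub>G\<^esub> y"] assms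
    by (simp add: bracket_add_left bracket_add_right bracket_self[of x] bracket_self[of y]
        bracket_closed M.a_comm)
  then show ?thesis
    using assms by (intro M.minus_equality[symmetric]) (simp_all add: bracket_closed)
qed

lemma bracket_minus_right:
  assumes "x \<in> carrier G" "y \<in> carrier G"
  shows "bracket x (\<ominus>\<^bsub>G\<^esub> y) = \<ominus>\<^bsub>G\<^esub> bracket x y"
proof -
  have "bracket x (\<ominus>\<^bsub>G\<^esub> y) \<oplus>\<^bsub>G\<^esub> bracket x y = \<zero>\<^bsub>G\<^esub>"
    using assms by (simp add: bracket_add_right[symmetric] M.l_neg bracket_zero)
  then show ?thesis
    using assms by (intro M.minus_equality[symmetric]) (simp_all add: bracket_closed)
qed

text \<open>The Jacobi identity solved for its first term by anticommutativity:
  \<open>bracket x\<close> acts as a derivation. Without minus signs it serves the Yang-Baxter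
  computation by splitting one tensor into two.\<close>

lemma bracket_derivation:
  assumes "x \<in> carrier G" "y \<in> carrier G" "z \<in> carrier G"
  shows "bracket x (bracket y z) = bracket y (bracket x z) \<oplus>\<^bsub>G\<^esub> bracket (bracket x y) z"
proof -
  have "bracket y (bracket z x) = \<ominus>\<^bsub>G\<^esub> bracket y (bracket x z)"
    "bracket z (bracket x y) = \<ominus>\<^bsub>G\<^esub> bracket (bracket x y) z"
    using assms bracket_anticomm[of x z] bracket_anticomm[of "bracket x y" z]
    by (simp_all add: bracket_minus_right bracket_closed)
  then have "bracket x (bracket y z) \<ominus>\<^bsub>G\<^esub>
      (bracket y (bracket x z) \<oplus>\<^bsub>G\<^esub> bracket (bracket x y) z) = \<zero>\<^bsub>G\<^esub>"
    using jacobi[OF assms] assms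
    by (simp add: a_minus_def M.minus_add bracket_closed M.a_assoc)
  then show ?thesis
    by (rule M.minus_zero_imp_eq) (simp_all add: assms bracket_closed)
qed

section \<open>The braiding on twofold and threefold tensors\<close>

lemma e_closed: "e \<in> carrier V"
  by (simp add: lie_braided_space_simps)

lemma br_closed: "u \<in> carrier V \<Longrightarrow> v \<in> carrier V \<Longrightarrow> br u v \<in> carrier V"
  by (auto simp: lie_braided_space_simps bracket_closed)

lemma br_bilinear: "bilinear_on K V V V (\<lambda>u v. br u v)"
  by (rule bilinear_onI)
    (auto simp: lie_braided_space_simps bracket_closed bracket_add_left bracket_add_right
      bracket_smult_left bracket_smult_right)

lemma V2_module: "module K V2"
  by (intro tensor_module_module lie_braided_space_module)

lemma V3_module: "module K V3"
  by (intro tensor_module_module V2_module lie_braided_space_module)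

lemmas pure2_bilinear = pure_tensor_bilinear[OF lie_braided_space_module lie_braided_space_module]
lemmas pure2_closed = bilinear_onD(1)[OF pure2_bilinear]
lemmas V_V2_bilinear = pure_tensor_bilinear[OF lie_braided_space_module V2_module]

lemma lie_braiding_bilinear:
  "bilinear_on K V V V2 (\<lambda>u v. pure2 v u \<oplus>\<^bsub>V2\<^esub> pure2 (br u v) e)"
  by (intro bilinear_add V2_module bilinear_swap[OF pure2_bilinear]
      bilinear_comp[OF br_bilinear module_hom_id module_hom_id
        bilinear_left_hom[OF pure2_bilinear e_closed]])

text \<open>Projections replace the pair patterns, so \<open>u\<close> and \<open>v\<close> can
  remain variables and the facts on \<open>tensor_lift\<close> apply directly.\<close>

lemma lie_braiding_eq:
  "S = tensor_lift K V V V2 (\<lambda>u v. pure2 v u \<oplus>\<^bsub>V2\<^esub> pure2 (br u v) e)"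
  by (simp add: lie_braiding_def Let_def split_beta')

lemma lie_braiding_hom: "S \<in> module_hom K V2 V2"
  unfolding lie_braiding_eq
  by (rule tensor_lift(1)[OF lie_braided_space_module lie_braided_space_module V2_module
        lie_braiding_bilinear])

lemma lie_braiding_pure:
  "u \<in> carrier V \<Longrightarrow> v \<in> carrier V \<Longrightarrow> S (pure2 u v) = pure2 v u \<oplus>\<^bsub>V2\<^esub> pure2 (br u v) e"
  unfolding lie_braiding_eq
  by (rule tensor_lift(2)[OF lie_braided_space_module lie_braided_space_module V2_module
        lie_braiding_bilinear])

lemma pure3_closed:
  "u \<in> carrier V \<Longrightarrow> v \<in> carrier V \<Longrightarrow> w \<in> carrier V \<Longrightarrow> pure3 u v w \<in> carrier V3"
  by (intro bilinear_onD(1)[OF V_V2_bilinear] pure2_closed)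

lemma lie_braiding_id_tensor:
  assumes "u \<in> carrier V" "v \<in> carrier V" "w \<in> carrier V"
  shows "id_tensor K V S (pure3 u v w) = pure3 u w v \<oplus>\<^bsub>V3\<^esub> pure3 u (br v w) e"
  using assms
  by (simp add: id_tensor_pure[OF lie_braided_space_module lie_braiding_hom] pure2_closed
      lie_braiding_pure br_closed e_closed bilinear_onD(3)[OF V_V2_bilinear])

text \<open>\<open>S\<close> turns the first two factors into a sum of two pure tensors; additivity
  in the left slot splits it, and \<open>tensor_assoc\<close> rebrackets each summand. The factor
  \<open>e\<close> lands in the middle slot here, but in the last slot for
  \<open>id_tensor\<close>.\<close>

lemma lie_braiding_tensor_id:
  assumes "u \<in> carrier V" "v \<in> carrier V" "w \<in> carrier V"
  shows "tensor_id K V S (pure3 u v w) = pure3 v u w \<oplus>\<^bsub>V3\<^esub> pure3 (br u v) e w"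
proof -
  note M = lie_braided_space_module
  note B = pure_tensor_bilinear[OF V2_module M]
  show ?thesis
    using assms
    by (simp add: tensor_id_pure[OF M lie_braiding_hom] pure2_closed lie_braiding_pure br_closed
        e_closed bilinear_onD(1,2)[OF B] module_homD(2)[OF tensor_assoc_hom[OF M M M]]
        tensor_assoc_pure[OF M M M])
qed

section \<open>The Yang-Baxter equation\<close>

lemma pure3_zero:
  assumes "u \<in> carrier V" "v \<in> carrier V"
  shows "pure3 \<zero>\<^bsub>V\<^esub> u v = \<zero>\<^bsub>V3\<^esub>" "pure3 u \<zero>\<^bsub>V\<^esub> v = \<zero>\<^bsub>V3\<^esub>"
proof -
  note M = lie_braided_space_module
  show "pure3 \<zero>\<^bsub>V\<^esub> u v = \<zero>\<^bsub>V3\<^esub>"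
    using assms by (intro pure_tensor_zero_left M V2_module pure2_closed)
  show "pure3 u \<zero>\<^bsub>V\<^esub> v = \<zero>\<^bsub>V3\<^esub>"
    unfolding pure_tensor_zero_left[OF M M assms(2)]
    by (rule module_hom_zero[OF V2_module V3_module bilinear_right_hom[OF V_V2_bilinear assms(1)]])
qed

lemma br_e:
  assumes "u \<in> carrier V"
  shows "br u e = \<zero>\<^bsub>V\<^esub>" "br e u = \<zero>\<^bsub>V\<^esub>"
  using assms by (auto simp: lie_braided_space_simps bracket_zero)

lemma br_derivation:
  assumes "u \<in> carrier V" "v \<in> carrier V" "w \<in> carrier V"
  shows "br u (br v w) = br v (br u w) \<oplus>\<^bsub>V\<^esub> br (br u v) w"
  using assms bracket_derivation[of "snd u" "snd v" "snd w"]
  by (simp add: lie_braided_space_simps mem_Times_iff)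

lemma lie_braiding_yang_baxter:
  assumes "t \<in> carrier V3"
  shows "id_tensor K V S (tensor_id K V S (id_tensor K V S t)) =
    tensor_id K V S (id_tensor K V S (tensor_id K V S t))"
proof -
  note M = lie_braided_space_module
  interpret V3: module K V3 by (rule V3_module)
  let ?i = "id_tensor K V S" and ?s = "tensor_id K V S"
  note I = id_tensor_hom[OF M lie_braiding_hom]
  note T = tensor_id_hom[OF M lie_braiding_hom]
  note add = module_homD(2)[OF I] module_homD(2)[OF T]
  note closed = br_closed e_closed pure3_closed
  \<comment> \<open>Both composites are linear, so agreement on threefold pure tensors
    suffices.\<close>
  show ?thesis
  proof (rule tensor_right_eqI[OF M M M V3_module
        module_hom_comp[OF module_hom_comp[OF I T] I] module_hom_comp[OF module_hom_comp[OF T I] T] _ assms])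
    \<comment> \<open>The six surviving terms in the order of each expansion. Writing tensors as
      words, \<open>p\<close>, \<open>q\<close>, \<open>r\<close>, \<open>s\<close> are wvu,
      w[u,v]e, [u,w]ve, [v,w]eu, while \<open>t\<close> and \<open>t'\<close> are [v,[u,w]]ee and
      [[u,v],w]ee.\<close>
    have ac: "p \<oplus>\<^bsub>V3\<^esub> q \<oplus>\<^bsub>V3\<^esub> r \<oplus>\<^bsub>V3\<^esub> (s \<oplus>\<^bsub>V3\<^esub> (t \<oplus>\<^bsub>V3\<^esub> t')) =
        p \<oplus>\<^bsub>V3\<^esub> s \<oplus>\<^bsub>V3\<^esub> (r \<oplus>\<^bsub>V3\<^esub> t) \<oplus>\<^bsub>V3\<^esub> (q \<oplus>\<^bsub>V3\<^esub> t')"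
      if "p \<in> carrier V3" "q \<in> carrier V3" "r \<in> carrier V3" "s \<in> carrier V3"
        "t \<in> carrier V3" "t' \<in> carrier V3" for p q r s t t'
      using that by (simp add: V3.a_ac)
    fix u v w assume uvw: "u \<in> carrier V" "v \<in> carrier V" "w \<in> carrier V"
    \<comment> \<open>The left composite yields the first nested bracket, the right composite the
      other two.\<close>
    have j: "pure3 (br u (br v w)) e e = pure3 (br v (br u w)) e e \<oplus>\<^bsub>V3\<^esub> pure3 (br (br u v) w) e e"
      unfolding br_derivation[OF uvw] using uvw
      by (intro bilinear_onD(2)[OF V_V2_bilinear] closed pure2_closed)
    show "?i (?s (?i (pure3 u v w))) = ?s (?i (?s (pure3 u v w)))"
      by (simp only: lie_braiding_id_tensor lie_braiding_tensor_id add closed V3.a_closed br_e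
          pure3_zero V3.r_zero V3.l_zero j uvw) (intro ac closed uvw)
  qed
qed

section \<open>Averaging operators\<close>

lemma pure_e_inj:
  assumes "x \<in> carrier G" "y \<in> carrier G" "pure2 (\<zero>\<^bsub>K\<^esub>, x) e = pure2 (\<zero>\<^bsub>K\<^esub>, y) e"
  shows "x = y"
proof -
  note M = lie_braided_space_module
  \<comment> \<open>Scalars commute, which makes the map below homogeneous in its left
    argument.\<close>
  have swap: "b \<odot>\<^bsub>G\<^esub> (a \<odot>\<^bsub>G\<^esub> z) = a \<odot>\<^bsub>G\<^esub> (b \<odot>\<^bsub>G\<^esub> z)"
    if "a \<in> carrier K" "b \<in> carrier K" "z \<in> carrier G" for a b z
    using that by (metis smult_assoc1 m_comm)
  have b: "bilinear_on K V V G (\<lambda>u v. fst v \<odot>\<^bsub>G\<^esub> snd u)"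
    by (rule bilinear_onI)
      (auto simp: lie_braided_space_simps smult_r_distr smult_l_distr smult_assoc1 swap)
  have "tensor_lift K V V G (\<lambda>u v. fst v \<odot>\<^bsub>G\<^esub> snd u) (pure2 (\<zero>\<^bsub>K\<^esub>, z) e) = z"
    if "z \<in> carrier G" for z
    using that e_closed
    by (subst tensor_lift(2)[OF M M module_axioms b]) (auto simp: lie_braided_space_simps)
  then show ?thesis using assms by metis
qed

lemma lie_braiding_braided_vector_space: "braided_vector_space K V S"
proof -
  interpret V: module K V by (rule lie_braided_space_module)
  show ?thesis by unfold_locales (fact lie_braiding_hom lie_braiding_yang_baxter)+
qed

lemma lie_braided_space_lift_hom:
  assumes "P \<in> module_hom K G G"
  shows "(\<lambda>(a, x). (a, P x)) \<in> module_hom K V V"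
  by (rule module_homI) (auto simp: lie_braided_space_simps module_homD[OF assms])

text \<open>The flipped term \<open>pure2 (b, P y) (a, P x)\<close> arises on both sides and
  cancels. After expansion \<open>a\<close> and \<open>b\<close> occur nowhere else, so the
  condition does not depend on them.\<close>

lemma lie_braiding_averaging_iff:
  assumes P: "P \<in> module_hom K G G" and "a \<in> carrier K" "x \<in> carrier G" "b \<in> carrier K" "y \<in> carrier G"
  shows "S (pure2 (a, P x) (b, P y)) =
      tensor_map K V V V V (\<lambda>(a, x). (a, P x)) (\<lambda>v. v) (S (pure2 (a, P x) (b, y))) \<longleftrightarrow>
    bracket (P x) (P y) = P (bracket (P x) y)"
proof -
  note M = lie_braided_space_module
  interpret V2: module K V2 by (rule V2_module)
  let ?A = "\<lambda>(a, x). (a, P x)"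
  note A = lie_braided_space_lift_hom[OF P]
  note P_closed = module_homD(1)[OF P]
  have u: "(a, P x) \<in> carrier V" and v: "(b, y) \<in> carrier V" and v': "(b, P y) \<in> carrier V"
    using assms P_closed by (simp_all add: lie_braided_space_simps)
  have c: "bracket (P x) (P y) \<in> carrier G" "bracket (P x) y \<in> carrier G"
    using assms by (simp_all add: bracket_closed P_closed)
  have c': "(\<zero>\<^bsub>K\<^esub>, z) \<in> carrier V" if "z \<in> carrier G" for z
    using that by (simp add: lie_braided_space_simps)
  have p: "pure2 v u \<in> carrier V2" if "v \<in> carrier V" "u \<in> carrier V" for u v
    using that by (rule pure2_closed)
  note tensor_map_A = tensor_map[OF M M M M A module_hom_id]
  have "tensor_map K V V V V ?A (\<lambda>v. v) (S (pure2 (a, P x) (b, y))) =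
      pure2 (b, P y) (a, P x) \<oplus>\<^bsub>V2\<^esub> pure2 (\<zero>\<^bsub>K\<^esub>, P (bracket (P x) y)) e"
    using u v c
    by (simp add: lie_braiding_pure module_homD(2)[OF tensor_map_A(1)] tensor_map_A(2) p c' e_closed)
  moreover have "S (pure2 (a, P x) (b, P y)) =
      pure2 (b, P y) (a, P x) \<oplus>\<^bsub>V2\<^esub> pure2 (\<zero>\<^bsub>K\<^esub>, bracket (P x) (P y)) e"
    using u v' by (simp add: lie_braiding_pure)
  ultimately show ?thesis
    using u v' c pure_e_inj[of "bracket (P x) (P y)" "P (bracket (P x) y)"]
    by (auto simp: p c' e_closed P_closed)
qed

end

theorem proposition5p8:
  fixes K :: "('k, 'r) ring_scheme"
    and G :: "('k, 'g, 'm) module_scheme"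
    and bracket :: "'g \<Rightarrow> 'g \<Rightarrow> 'g"
    and P :: "'g \<Rightarrow> 'g"
  assumes "lie_algebra K G bracket"
    and "P \<in> module_hom K G G"
  shows "lie_averaging_operator K G bracket P \<longleftrightarrow>
    braided_averaging_operator K (lie_braided_space K G) (lie_braiding K G bracket)
      (\<lambda>(a, x). (a, P x))"
proof -
  interpret lie_algebra K G bracket by fact
  note P = assms(2)
  have "lie_averaging_operator K G bracket P \<longleftrightarrow>
      (\<forall>x\<in>carrier G. \<forall>y\<in>carrier G. bracket (P x) (P y) = P (bracket (P x) y))"
    using P lie_algebra_axioms
    by (auto simp: lie_averaging_operator_def lie_averaging_operator_axioms_def)
  also have "\<dots> \<longleftrightarrow> (\<forall>u\<in>carrier V. \<forall>v\<in>carrier V.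
      S (pure2 (fst u, P (snd u)) (fst v, P (snd v))) =
      tensor_map K V V V V (\<lambda>(a, x). (a, P x)) (\<lambda>v. v) (S (pure2 (fst u, P (snd u)) v)))"
    \<comment> \<open>Recovering the condition on \<open>x\<close> and \<open>y\<close> requires
      some scalar to complete them to pairs; any scalar gives the same condition.\<close>
    using zero_closed by (auto simp: lie_braided_space_simps(1) lie_braiding_averaging_iff[OF P])
  \<comment> \<open>The braided structure and the linearity of the lifted map are already
    established, so the predicate reduces to its averaging identity.\<close>
  also have "\<dots> \<longleftrightarrow> braided_averaging_operator K V S (\<lambda>(a, x). (a, P x))"
    using lie_braided_space_lift_hom[OF P] lie_braiding_braided_vector_space
    unfolding split_beta' braided_averaging_operator_def braided_averaging_operator_axioms_def
    by blast
  finally show ?thesis .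
qed

end
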